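(* Let $P$ be a $3\times n$ transportation polytope and let $k$ be the number of its critical edges. Then the graph diameter of $P$ is at most $n+2-k$; in particular it is at most $n+2$.
   Context: For $u\in\mathbb{R}^3_{>0}$, $v\in\mathbb{R}^n_{>0}$ with $\sum_i u_i=\sum_j v_j$, the $3\times n$ transportation polytope is $P=\{y\in\mathbb{R}^{3\times n}: \sum_j y_{ij}=u_i\ (i\in[3]),\ \sum_i y_{ij}=v_j\ (j\in[n]),\ y\ge 0\}$. A pair $(i,j)$ (an edge $\{\mathfrak{s}_i,\mathfrak{d}_j\}$ of $K_{3,n}$) is critical for $P$ if $y_{ij}>0$ for every $y\in P$. The graph diameter is the diameter of the $1$-skeleton of $P$. *)

theory Defs
  imports "HOL-Analysis.Analysis" "HOL-Library.Extended_Nat"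
begin

definition transportation_polytope ::
  "real ^ 'm \<Rightarrow> real ^ 'n \<Rightarrow> (real ^ 'n ^ 'm) set" where
  "transportation_polytope u v =
     {y. (\<forall>i. (\<Sum>j\<in>UNIV. y $ i $ j) = u $ i) \<and>
         (\<forall>j. (\<Sum>i\<in>UNIV. y $ i $ j) = v $ j) \<and>
         (\<forall>i j. y $ i $ j \<ge> 0)}"

(* The pair (i, j) stands for the edge joining supply node i and demand node j
   of the complete bipartite graph. *)
definition critical_edges :: "(real ^ 'n ^ 'm) set \<Rightarrow> ('m \<times> 'n) set" where
  "critical_edges P = {(i, j). \<forall>y\<in>P. y $ i $ j > 0}"

definition skeleton_vertices :: "'a::euclidean_space set \<Rightarrow> 'a set" where
  "skeleton_vertices P = {x. x extreme_point_of P}"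

definition skeleton_edges :: "'a::euclidean_space set \<Rightarrow> 'a rel" where
  "skeleton_edges P =
     {(x, y). x \<in> skeleton_vertices P \<and> y \<in> skeleton_vertices P \<and>
              closed_segment x y edge_of P}"

(* For a graph given by its adjacency relation E, (x, y) \<in> E ^^ l says that there is
   a walk with l edges from x to y; the distance is \<infinity> if there is no walk. *)
definition graph_distance :: "'a rel \<Rightarrow> 'a \<Rightarrow> 'a \<Rightarrow> enat" where
  "graph_distance E x y = (INF l\<in>{l. (x, y) \<in> E ^^ l}. enat l)"

definition graph_diameter :: "'a::euclidean_space set \<Rightarrow> enat" where
  "graph_diameter P =
     (SUP x\<in>skeleton_vertices P. SUP y\<in>skeleton_vertices P.
        graph_distance (skeleton_edges P) x y)"

end

theory Submission
  imports Defs
begin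

text \<open>
  In a nondegenerate polytope vertices are spanning trees. Fix the target tree \<open>F\<close>; we pivot
  towards it, inserting only edges of \<open>F\<close>, each at most once. Critical edges lie in every tree and
  are never inserted, so the number of pivots is at most \<open>n + 2 - k\<close>.

  Root \<open>F\<close> at a row which is an end of the tree obtained by deleting the leaf columns. Every column
  then has a parent row, to which it wants to move its mass. First only the edges from columns to
  their parents are inserted, and these are never deleted. If this gets stuck, then some row
  receives no wanted mass or emits none. Comparing its row sum with that of the target shows that
  one further edge of \<open>F\<close>, from a row to its parent column, may be inserted and kept, until the
  directions of the wanted moves are acyclic; and from such a tree \<open>F\<close> can be reached without ever
  deleting an edge of \<open>F\<close>.

  Degenerate polytopes are perturbed. For suitable arbitrarily small perturbations the walk has
  a constant sequence of supports, and its limit is a walk in the original polytope.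
\<close>

section \<open>Support graphs with three rows\<close>

text \<open>A protected edge never gives off mass, so it supplies no arc; protecting every target
  edge already present would bound the walk at once but may leave too few arcs for any insertion.
  Each later step therefore leaves a few target edges unprotected. Such an edge may be drained, yet
  it cannot leave the support: without it some row of the new vertex would be entrywise at most, or
  at least, the same row of the target, equal row sums would force equality, and equality fails at a
  known entry. Only one row edge can be kept early because of the budget: every target edge may be
  charged once, and the row edge left to the final phase may meanwhile be lost. Hence phases that
  follow one another must work with the same row edge.\<close>

definition flow_arc :: "('r \<Rightarrow> 'c \<Rightarrow> bool) \<Rightarrow> ('r \<times> 'c) set \<Rightarrow> 'r \<Rightarrow> 'r \<Rightarrow> bool" where
  "flow_arc E Pr a b \<longleftrightarrow> a \<noteq> b \<and> (\<exists>k. E a k \<and> E b k \<and> (a, k) \<notin> Pr)"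

text \<open>
  \<open>E\<close> is the support graph of a vertex and \<open>Pr\<close> a set of protected edges. Along an arc from \<open>a\<close> to
  \<open>b\<close> some column may shift mass from row \<open>a\<close> to row \<open>b\<close> without endangering a protected edge.
  Inserting \<open>(s, j)\<close> drains an edge \<open>(a, j)\<close> and closes up along arcs from \<open>s\<close> to \<open>a\<close>; as there are
  three rows, at most two arcs are needed.
\<close>

definition insertable :: "('r \<Rightarrow> 'c \<Rightarrow> bool) \<Rightarrow> ('r \<times> 'c) set \<Rightarrow> 'r \<Rightarrow> 'c \<Rightarrow> bool" where
  "insertable E Pr s j \<longleftrightarrow> \<not> E s j \<and>
     (\<exists>a. E a j \<and> (a, j) \<notin> Pr \<and> (flow_arc E Pr s a \<or> (\<exists>m. flow_arc E Pr s m \<and> flow_arc E Pr m a)))"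

text \<open>Spanning trees without paths or cycles of arbitrary length: with three rows, each cut of
  the row set has a single row on one side, and each cycle has length four or six.\<close>

locale tree_support =
  fixes E :: "'r \<Rightarrow> 'c \<Rightarrow> bool"
  assumes cut: "\<And>i. \<exists>k m. m \<noteq> i \<and> E i k \<and> E m k"
    and no_square: "\<And>a b j k. E a j \<Longrightarrow> E b j \<Longrightarrow> E a k \<Longrightarrow> E b k \<Longrightarrow> a \<noteq> b \<Longrightarrow> j = k"
    and no_hexagon: "\<And>a b c j k l. E a j \<Longrightarrow> E b j \<Longrightarrow> E b k \<Longrightarrow> E c k \<Longrightarrow> E c l \<Longrightarrow> E a l \<Longrightarrow>
       a \<noteq> b \<Longrightarrow> b \<noteq> c \<Longrightarrow> a \<noteq> c \<Longrightarrow> j = k \<or> k = l \<or> j = l"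
    and column_nonempty: "\<And>j. \<exists>i. E i j"
begin

section \<open>Existence of an insertion under partial protection\<close>

lemma flow_arcI: "E a k \<Longrightarrow> E b k \<Longrightarrow> (a, k) \<notin> Pr \<Longrightarrow> a \<noteq> b \<Longrightarrow> flow_arc E Pr a b"
  unfolding flow_arc_def by blast

lemma ins1: "\<not> E s j \<Longrightarrow> E a j \<Longrightarrow> (a, j) \<notin> Pr \<Longrightarrow> flow_arc E Pr s a \<Longrightarrow> insertable E Pr s j"
  unfolding insertable_def by blast

lemma ins2: "\<not> E s j \<Longrightarrow> E a j \<Longrightarrow> (a, j) \<notin> Pr \<Longrightarrow> flow_arc E Pr s m \<Longrightarrow> flow_arc E Pr m a \<Longrightarrow> insertable E Pr s j"
  unfolding insertable_def by blast

text \<open>Here row \<open>t\<close> emits no wanted mass. The column edge \<open>(t, k)\<close> is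
  left unprotected, so that it can be drained in favour of \<open>(s, k)\<close> and can supply
  arcs; that it nevertheless survives is settled later by a row sum. In each case either
  \<open>(s, k)\<close> can enter or the misplaced mass in \<open>j1\<close> or \<open>j2\<close>
  can move to its parent.\<close>

lemma step_in:
  assumes rows: "\<And>i. i = s \<or> i = r \<or> i = t" and dist: "s \<noteq> r" "s \<noteq> t" "r \<noteq> t"
    and k: "b k = t" "E t k"
    and allin: "\<And>j. E t j \<Longrightarrow> b j = t"
    and w1: "b j1 = r" "E s j1" and w2: "b j2 \<noteq> r" "E r j2"
    and Pr: "Pr = {(b j, j) | j. j \<noteq> k} \<union> {(s, k)}"
  shows "(\<exists>j. insertable E Pr (b j) j) \<or> insertable E Pr s k"
proof (cases "E s k")
  case False
  obtain l m where l: "m \<noteq> s" "E s l" "E m l" using cut by blast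
  have lk: "l \<noteq> k" using False l by blast
  show ?thesis
  proof (cases "b l = s")
    case True
    then have mr: "m = r" using l allin rows dist by metis
    have "flow_arc E Pr r s" using l mr lk True dist by (intro flow_arcI[of r l]) (auto simp: Pr)
    moreover have "\<not> E r j1" using no_square[of s j1 r l] l mr w1 True dist by auto
    ultimately have "insertable E Pr r j1" using w1 k dist by (intro ins1[of r j1 s]) (auto simp: Pr False)
    then show ?thesis using w1 by metis
  next
    case bs: False
    have sm: "flow_arc E Pr s m" using l lk bs by (intro flow_arcI[of s l]) (auto simp: Pr)
    have tk: "(t, k) \<notin> Pr" using dist k by (auto simp: Pr)
    show ?thesis
    proof (cases "m = t \<or> E r k")
      case True
      then have "E m k" "(m,k) \<notin> Pr" using rows l k tk dist by (auto simp: Pr)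
      then show ?thesis using sm False ins1 by blast
    next
      case mt: False
      then have mr: "m = r" using l rows by blast
      obtain l' m' where l': "m' \<noteq> t" "E t l'" "E m' l'" using cut by blast
      have "l' \<noteq> k" using l' mt False rows by metis
      have "b l' = t" using l' allin by blast
      have "flow_arc E Pr m' t" using l' \<open>l' \<noteq> k\<close> \<open>b l' = t\<close> by (intro flow_arcI[of m' l']) (auto simp: Pr)
      then show ?thesis using sm mr l' rows False k tk ins1[of s k t] ins2[of s k t] by metis
    qed
  qed
next
  case sk: True
  \<comment> \<open>Column \<open>k\<close> now carries an arc from \<open>t\<close> to
    \<open>s\<close>, so a missing \<open>(r, j1)\<close> can enter as soon as \<open>r\<close> has
    an arc to \<open>s\<close> or \<open>t\<close>.\<close>
  have ts: "flow_arc E Pr t s" using sk k dist by (intro flow_arcI[of t k]) (auto simp: Pr)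
  have j1k: "j1 \<noteq> k" using w1 k dist by auto
  have ins_j1: ?thesis if "flow_arc E Pr r s \<or> flow_arc E Pr r t" "\<not> E r j1"
  proof -
    have "(s, j1) \<notin> Pr" using w1 j1k dist by (auto simp: Pr)
    then have "insertable E Pr r j1" using that ts w1 ins1 ins2 by metis
    then show ?thesis using w1 by metis
  qed
  show ?thesis
  proof (cases "E r k")
    case True
    have "flow_arc E Pr r s" using True sk k dist by (intro flow_arcI[of r k]) (auto simp: Pr)
    moreover have "\<not> E r j1" using no_square[of r k s j1] True sk w1 j1k dist by auto
    ultimately show ?thesis using ins_j1 by blast
  next
    case rk: False
    obtain l m where l: "m \<noteq> r" "E r l" "E m l" using cut by blast
    have lk: "l \<noteq> k" using rk l by blast
    show ?thesis
    proof (cases "E t l")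
      case True
      have "b l = t" using True allin by blast
      have "flow_arc E Pr r t" using True l lk \<open>b l = t\<close> dist by (intro flow_arcI[of r l]) (auto simp: Pr)
      moreover have "\<not> E r j1"
        using no_hexagon[of s j1 r l t k] True l lk w1 sk k j1k dist \<open>b l = t\<close> by auto
      ultimately show ?thesis using ins_j1 by blast
    next
      case tl: False
      have sl: "E s l" using l tl rows by metis
      show ?thesis
      proof (cases "b l = r")
        case False
        have "flow_arc E Pr r s" using l sl lk False dist by (intro flow_arcI[of r l]) (auto simp: Pr)
        moreover have "\<not> E r j1" using no_square[of s j1 r l] l sl w1 False dist by auto
        ultimately show ?thesis using ins_j1 by blast
      next
        case True
        have sr: "flow_arc E Pr s r" using l sl lk True dist by (intro flow_arcI[of s l]) (auto simp: Pr)
        have j2k: "j2 \<noteq> k" using w2 rk by auto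
        have r2: "(r, j2) \<notin> Pr" using w2 j2k by (auto simp: Pr)
        show ?thesis
        proof (cases "b j2 = s")
          case True
          have "\<not> E s j2" using no_square[of s j2 r l] l sl w2 True \<open>b l = r\<close> dist by auto
          then have "insertable E Pr s j2" using w2 r2 sr by (intro ins1)
          then show ?thesis using True by metis
        next
          case False
          then have bt: "b j2 = t" using rows w2 by blast
          have "\<not> E t j2" using no_hexagon[of s l r j2 t k] l sl w2 sk k j2k lk bt True dist by auto
          then have "insertable E Pr t j2" using w2 r2 ts sr by (intro ins2)
          then show ?thesis using bt by metis
        qed
      qed
    qed
  qed
qed

text \<open>Here row \<open>q\<close> receives no wanted mass, so every column other than
  \<open>k\<close> that \<open>q\<close> shares has its parent elsewhere and yields an arc out of
  \<open>q\<close>. The edge \<open>(p, k)\<close> is protected only while \<open>r\<close> meets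
  \<open>k\<close>; otherwise it is the only edge of \<open>k\<close> outside \<open>q\<close>, and
  a row sum at \<open>q\<close> will keep it alive.\<close>

lemma step_out:
  assumes rows: "\<And>i. i = q \<or> i = p \<or> i = r" and dist: "q \<noteq> p" "q \<noteq> r" "p \<noteq> r"
    and k: "b k = p" "E p k \<or> E r k"
    and allout: "\<And>j a. b j = q \<Longrightarrow> E a j \<Longrightarrow> a = q"
    and w1: "b j1 = r" "E p j1" and w2: "b j2 = p" "E r j2"
    and Pr: "Pr = {(b j, j) | j. j \<noteq> k \<or> E r k} \<union> {(q, k)}"
  shows "(\<exists>j. insertable E Pr (b j) j) \<or> insertable E Pr q k"
proof -
  have j1k: "j1 \<noteq> k" using w1 k dist by auto
  have p1: "(p, j1) \<notin> Pr" using w1 j1k dist by (auto simp: Pr)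
  have r2: "(r, j2) \<notin> Pr" using w2 dist by (auto simp: Pr)
  have ins_j1: ?thesis if "flow_arc E Pr r p \<or> (flow_arc E Pr r q \<and> flow_arc E Pr q p)" "\<not> E r j1"
    using that p1 w1 ins1[of r j1 p] ins2[of r j1 p] by metis
  have ins_j2: ?thesis if "flow_arc E Pr p r \<or> (flow_arc E Pr p q \<and> flow_arc E Pr q r)" "\<not> E p j2"
    using that r2 w2 ins1[of p j2 r] ins2[of p j2 r] by metis
  \<comment> \<open>The row of \<open>l\<close> that is not its parent gets the protection-free end
    of the column, and hence an arc comes from it or goes to it as needed; a square would arise if
    the parent edge at \<open>j1\<close> or \<open>j2\<close> were already present.\<close>
  have pr: ?thesis if l: "E p l" "E r l" "l \<noteq> k" for l
  proof (cases "b l = p")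
    case True
    have "flow_arc E Pr r p" using l True dist by (intro flow_arcI[of r l]) (auto simp: Pr)
    moreover have "\<not> E r j1" using no_square[of p j1 r l] l w1 True dist by auto
    ultimately show ?thesis using ins_j1 by blast
  next
    case False
    then have br: "b l = r" using allout l rows dist by metis
    have "flow_arc E Pr p r" using l False dist by (intro flow_arcI[of p l]) (auto simp: Pr)
    moreover have "\<not> E p j2" using no_square[of p j2 r l] l w2 br dist by auto
    ultimately show ?thesis using ins_j2 by blast
  qed
  have pkr: ?thesis if l: "E p k" "E r k"
  proof -
    have "flow_arc E Pr r p" using that k dist by (intro flow_arcI[of r k]) (auto simp: Pr)
    moreover have "\<not> E r j1" using no_square[of p j1 r k] l w1 k dist by auto
    ultimately show ?thesis using ins_j1 by blast
  qed
  have outq: "flow_arc E Pr q a" if "E q l" "E a l" "l \<noteq> k" "a \<noteq> q" for l a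
    using that allout by (intro flow_arcI[of q l]) (auto simp: Pr)
  show ?thesis
  proof (cases "E q k")
    case False
    obtain l m where l: "m \<noteq> q" "E q l" "E m l" using cut by blast
    have lk: "l \<noteq> k" using l False by blast
    have qm: "flow_arc E Pr q m" using outq l lk by blast
    show ?thesis
    proof (cases "E r k")
      case True
      have rk: "(r, k) \<notin> Pr" using k dist by (auto simp: Pr)
      show ?thesis
      proof (cases "m = r")
        case True
        then show ?thesis using ins1[of q k r] False \<open>E r k\<close> rk qm by blast
      next
        case mr: False
        then have mp: "m = p" using l rows by blast
        show ?thesis
        proof (cases "E p k")
          case True then show ?thesis using pkr \<open>E r k\<close> by blast
        next
          case pk: False
          obtain l' m' where l': "m' \<noteq> r" "E r l'" "E m' l'" using cut by blast
          have l'k: "l' \<noteq> k" using l' pk False rows by metis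
          show ?thesis
          proof (cases "m' = q")
            case True
            then have "flow_arc E Pr q r" using outq l' l'k dist by blast
            then show ?thesis using ins1[of q k r] False \<open>E r k\<close> rk by blast
          next
            case False
            then show ?thesis using pr[of l'] l' l'k rows by metis
          qed
        qed
      qed
    next
      case rk: False
      then have pk: "E p k" "(p, k) \<notin> Pr" using k dist by (auto simp: Pr)
      show ?thesis
      proof (cases "m = p")
        case True
        then show ?thesis using ins1[of q k p] False pk qm by blast
      next
        case mp: False
        obtain l' m' where l': "m' \<noteq> p" "E p l'" "E m' l'" using cut by blast
        have l'k: "l' \<noteq> k" using l' rk False rows by metis
        show ?thesis
        proof (cases "m' = q")
          case True
          then have "flow_arc E Pr q p" using outq l' l'k dist by blast
          then show ?thesis using ins1[of q k p] False pk by blast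
        next
          case False
          then show ?thesis using pr[of l'] l' l'k rows by metis
        qed
      qed
    qed
  next
    case qk: True
    show ?thesis
    proof (cases "E r k")
      case rk: True
      show ?thesis
      proof (cases "E p k")
        case True then show ?thesis using pkr rk by blast
      next
        case pk: False
        have rq: "flow_arc E Pr r q" using rk qk k dist by (intro flow_arcI[of r k]) (auto simp: Pr)
        obtain l m where l: "m \<noteq> p" "E p l" "E m l" using cut by blast
        have lk: "l \<noteq> k" using l pk by blast
        show ?thesis
        proof (cases "E q l")
          case True
          have qp: "flow_arc E Pr q p" using outq True l lk dist by blast
          show ?thesis
          proof (cases "E r j1")
            case True
            then have "l = j1" using no_hexagon[of p l q k r j1] l \<open>E q l\<close> qk rk w1 lk j1k dist by auto
            then have False using no_square[of r k q j1] True \<open>E q l\<close> qk rk lk dist by auto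
            then show ?thesis ..
          next
            case False
            then show ?thesis using ins_j1 rq qp by blast
          qed
        next
          case False
          then have "m = r" using l rows by metis
          then show ?thesis using pr[of l] l lk by metis
        qed
      qed
    next
      case rk: False
      then have pk: "E p k" "(p, k) \<notin> Pr" using k dist by (auto simp: Pr)
      have pq: "flow_arc E Pr p q" using pk qk dist by (intro flow_arcI[of p k]) auto
      obtain l m where l: "m \<noteq> r" "E r l" "E m l" using cut by blast
      have lk: "l \<noteq> k" using l rk by blast
      have j2k: "j2 \<noteq> k" using w2 rk by auto
      show ?thesis
      proof (cases "E q l")
        case True
        have qr: "flow_arc E Pr q r" using outq True l lk dist by blast
        show ?thesis
        proof (cases "E p j2")
          case True
          then have "l = j2" using no_hexagon[of r l q k p j2] l \<open>E q l\<close> qk pk w2 lk j2k dist by auto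
          then have False using no_square[of p k q j2] True \<open>E q l\<close> qk pk lk dist by auto
          then show ?thesis ..
        next
          case False
          then show ?thesis using ins_j2 pq qr by blast
        qed
      next
        case False
        then have "m = p" using l rows by metis
        then show ?thesis using pr[of l] l lk by metis
      qed
    qed
  qed
qed


text \<open>A route through three rows that repeats no row has at most two arcs, which is why
  \<open>insertable\<close> may stop at two.\<close>

lemma rtranclp_flow_arc_three:
  fixes r1 r2 r3 a e :: 'r
  assumes rows: "\<And>i. i = r1 \<or> i = r2 \<or> i = r3"
    and "(flow_arc E Pr)\<^sup>*\<^sup>* a e"
  shows "a = e \<or> flow_arc E Pr a e \<or> (\<exists>m. flow_arc E Pr a m \<and> flow_arc E Pr m e)"
  using assms(2)
proof (induction rule: rtranclp_induct)
  case (step y z)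
  have ne: "flow_arc E Pr i k \<Longrightarrow> i \<noteq> k" for i k by (simp add: flow_arc_def)
  from step.IH show ?case
  proof (elim disjE exE conjE)
    fix m assume m: "flow_arc E Pr a m" "flow_arc E Pr m y"
    then have "z = a \<or> z = m \<or> y = a" using rows ne step.hyps(2) by metis
    then show ?thesis using m step.hyps(2) by metis
  qed (use step.hyps in blast)+
qed simp

text \<open>If nothing can enter, then a column with mass in a row reachable from its parent already
  has its parent edge, and so carries an arc to the parent. From a row reached by all rows this
  leads to another such row, and dually for a row reaching all. Three moves of this kind form a walk
  without backtracking in a tree with only three rows, which is impossible.\<close>

lemma step_initial:
  fixes r1 r2 r3 :: 'r
  assumes rows: "\<And>i. i = r1 \<or> i = r2 \<or> i = r3" and dist: "r1 \<noteq> r2" "r1 \<noteq> r3" "r2 \<noteq> r3"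
    and out: "\<And>i. \<exists>j. b j \<noteq> i \<and> E i j"
    and inn: "\<And>i. \<exists>j a. b j = i \<and> a \<noteq> i \<and> E a j"
    and Pr: "Pr = {(b j, j) | j. True}"
  shows "\<exists>j. insertable E Pr (b j) j"
proof (rule ccontr)
  assume no: "\<not> ?thesis"
  let ?R = "(flow_arc E Pr)\<^sup>*\<^sup>*"
  have present: "E (b j) j" if "E a j" "a \<noteq> b j" "?R (b j) a" for a j
    using that no rtranclp_flow_arc_three[OF rows that(3)] unfolding insertable_def by (auto simp: Pr)
  have cyc: False if "E t j1" "E (b j1) j1" "b j1 \<noteq> t" "E (b j1) j2" "E (b j2) j2" "b j2 \<noteq> b j1"
      "E (b j2) j3" "E (b j3) j3" "b j3 \<noteq> b j2" for t j1 j2 j3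
  proof -
    have "b j2 \<noteq> t" using no_square[of t j1 "b j1" j2] that by metis
    moreover have "b j3 \<noteq> b j1" using no_square[of "b j1" j2 "b j2" j3] that by metis
    ultimately have "b j3 = t"
      using that(3,6,9) rows[of t] rows[of "b j1"] rows[of "b j2"] rows[of "b j3"] by metis
    then show False using no_hexagon[of t j1 "b j1" j2 "b j2" j3] that \<open>b j2 \<noteq> t\<close> by metis
  qed
  have arcs: "\<exists>m. m \<noteq> i \<and> (flow_arc E Pr i m \<or> flow_arc E Pr m i)" for i
  proof -
    obtain k m where "m \<noteq> i" "E i k" "E m k" using cut by blast
    then show ?thesis using flow_arcI[of i k m Pr] flow_arcI[of m k i Pr] by (auto simp: Pr)
  qed
  \<comment> \<open>Every row has an arc to or from another one, so two arcs form a path on the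
    three rows. However these are oriented, some row is reached by all or reaches all.\<close>
  have "(\<exists>t. \<forall>s. ?R s t) \<or> (\<exists>t. \<forall>s. ?R t s)"
  proof -
    obtain m1 where m1: "m1 \<noteq> r1" "flow_arc E Pr r1 m1 \<or> flow_arc E Pr m1 r1" using arcs by blast
    obtain c where c: "c \<noteq> r1" "c \<noteq> m1" "\<And>i. i = r1 \<or> i = m1 \<or> i = c"
    proof (cases "m1 = r2")
      case True
      then show thesis using that[of r3] rows m1 dist by blast
    next
      case False
      then show thesis using that[of r2] rows m1 dist by blast
    qed
    obtain m2 where m2: "m2 = r1 \<or> m2 = m1" "flow_arc E Pr c m2 \<or> flow_arc E Pr m2 c" using arcs[of c] c by metis
    obtain m3 where m3: "m3 = r1 \<or> m3 = m1" "m3 \<noteq> m2" "\<And>i. i = m2 \<or> i = m3 \<or> i = c" 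
      "flow_arc E Pr m3 m2 \<or> flow_arc E Pr m2 m3" using m1 m2 c by metis
    have R [simp]: "?R i i" "flow_arc E Pr i k \<Longrightarrow> ?R i k" "flow_arc E Pr i k \<Longrightarrow> flow_arc E Pr k l \<Longrightarrow> ?R i l" for i k l
      by auto
    have all: "(\<forall>s. Q s) \<longleftrightarrow> Q c \<and> Q m2 \<and> Q m3" for Q using m3(3) by metis
    show ?thesis using m2(2) m3(4)
    proof (elim disjE)
      assume "flow_arc E Pr c m2" "flow_arc E Pr m3 m2"
      then have "\<forall>s. ?R s m2" unfolding all by auto
      then show ?thesis by blast
    next
      assume "flow_arc E Pr c m2" "flow_arc E Pr m2 m3"
      then have "\<forall>s. ?R s m3" unfolding all by auto
      then show ?thesis by blast
    next
      assume "flow_arc E Pr m2 c" "flow_arc E Pr m3 m2"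
      then have "\<forall>s. ?R s c" unfolding all by auto
      then show ?thesis by blast
    next
      assume "flow_arc E Pr m2 c" "flow_arc E Pr m2 m3"
      then have "\<forall>s. ?R m2 s" unfolding all by auto
      then show ?thesis by blast
    qed
  qed
  then show False
  proof (elim disjE exE)
    fix t assume t: "\<forall>s. ?R s t"
    have nxt: "\<exists>j. E t j \<and> E (b j) j \<and> b j \<noteq> t \<and> (\<forall>s. ?R s (b j))" if t: "\<forall>s. ?R s t" for t
    proof -
      obtain j where j: "b j \<noteq> t" "E t j" using out by blast
      then have "E (b j) j" using present t by metis
      moreover have "flow_arc E Pr t (b j)" using j calculation by (intro flow_arcI[of t j]) (auto simp: Pr)
      then have "\<forall>s. ?R s (b j)" using t by (metis rtranclp.rtrancl_into_rtrancl)
      ultimately show ?thesis using j by blast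
    qed
    obtain j1 where 1: "E t j1" "E (b j1) j1" "b j1 \<noteq> t" "\<forall>s. ?R s (b j1)" using nxt[OF t] by blast
    obtain j2 where 2: "E (b j1) j2" "E (b j2) j2" "b j2 \<noteq> b j1" "\<forall>s. ?R s (b j2)" using nxt[OF 1(4)] by blast
    obtain j3 where 3: "E (b j2) j3" "E (b j3) j3" "b j3 \<noteq> b j2" using nxt[OF 2(4)] by blast
    show False using cyc[OF 1(1-3) 2(1-3) 3] .
  next
    fix t assume t: "\<forall>s. ?R t s"
    have nxt: "\<exists>j a. b j = t \<and> E t j \<and> E a j \<and> a \<noteq> t \<and> (\<forall>s. ?R a s)" if t: "\<forall>s. ?R t s" for t
    proof -
      obtain j a where j: "b j = t" "a \<noteq> t" "E a j" using inn by blast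
      then have "E t j" using present t by metis
      moreover have "flow_arc E Pr a t" using j calculation by (intro flow_arcI[of a j]) (auto simp: Pr)
      then have "\<forall>s. ?R a s" using t by (meson converse_rtranclp_into_rtranclp)
      ultimately show ?thesis using j by blast
    qed
    obtain j1 a1 where 1: "b j1 = t" "E t j1" "E a1 j1" "a1 \<noteq> t" "\<forall>s. ?R a1 s" using nxt[OF t] by blast
    obtain j2 a2 where 2: "b j2 = a1" "E a1 j2" "E a2 j2" "a2 \<noteq> a1" "\<forall>s. ?R a2 s" using nxt[OF 1(5)] by blast
    obtain j3 a3 where 3: "b j3 = a2" "E a2 j3" "E a3 j3" "a3 \<noteq> a2" using nxt[OF 2(5)] by blast
    show False using cyc[of a3 j3 j2 j1] 1 2 3 by metis
  qed
qed

text \<open>Misplaced mass can only want to go from \<open>n\<close> to \<open>m\<close> or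
  \<open>r\<close>, or from \<open>m\<close> to \<open>r\<close>. The unprotected edges
  \<open>(r, c)\<close> and \<open>(m, d)\<close> are there to be drained for the row edges
  \<open>(m, c)\<close> and \<open>(n, d)\<close>. Once both row edges are present they give arcs
  from \<open>r\<close> to \<open>m\<close> and from \<open>m\<close> to \<open>n\<close>, against
  the wanted direction, and these close the cycle for any missing column edge.\<close>

lemma step_path:
  assumes rows: "\<And>i. i = n \<or> i = m \<or> i = r" and dist: "n \<noteq> m" "n \<noteq> r" "m \<noteq> r" "c \<noteq> d"
    and bc: "b c = r" "E r c" and bd: "b d = m" "E m d"
    and upn: "\<And>j a. b j = n \<Longrightarrow> E a j \<Longrightarrow> a = n" and upm: "\<And>j. b j = m \<Longrightarrow> \<not> E r j"
    and Pr: "Pr = {(b j, j) | j. j \<noteq> c \<and> j \<noteq> d} \<union> {(m, c), (n, d)}"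
    and miss: "(\<exists>j. \<not> E (b j) j) \<or> \<not> E m c \<or> \<not> E n d"
  shows "(\<exists>j. insertable E Pr (b j) j) \<or> insertable E Pr m c \<or> insertable E Pr n d"
proof -
  have free: "(m, d) \<notin> Pr" "(r, c) \<notin> Pr" "(n, c) \<notin> Pr" using dist by (auto simp: Pr)
  have outn: "flow_arc E Pr n a" if "E n l" "E a l" "l \<noteq> d" "a \<noteq> n" for l a
    using that upn dist by (intro flow_arcI[of n l]) (auto simp: Pr)
  have br: "b l = r" if "E r l" for l using that rows upn upm dist by metis
  show ?thesis
  proof (cases "E n d")
    case nd: False
    obtain l a where l: "a \<noteq> n" "E n l" "E a l" using cut by blast
    then have na: "flow_arc E Pr n a" using outn nd by blast
    show ?thesis
    proof (cases "a = m")
      case True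
      then show ?thesis using ins1[of n d m] nd bd free na by blast
    next
      case False
      then have ar: "a = r" using l rows by blast
      show ?thesis
      proof (cases "E m c")
        case True
        then have "flow_arc E Pr r m" using bc free dist by (intro flow_arcI[of r c]) auto
        then show ?thesis using ins2[of n d m Pr r] nd bd free na ar by blast
      next
        case mc: False
        obtain l' a' where l': "a' \<noteq> m" "E m l'" "E a' l'" using cut by blast
        show ?thesis
        proof (cases "a' = n")
          case True
          then have "flow_arc E Pr n m" using outn[of l' m] l' nd dist by blast
          then show ?thesis using ins1[of n d m] nd bd free by blast
        next
          case False
          then have "E r l'" using l' rows by metis
          then have "flow_arc E Pr m r" using l' mc br[of l'] bd dist by (intro flow_arcI[of m l']) (auto simp: Pr)
          then show ?thesis using ins1[of m c r] mc bc free by blast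
        qed
      qed
    qed
  next
    case nd: True
    have mn: "flow_arc E Pr m n" using nd bd free dist by (intro flow_arcI[of m d]) auto
    show ?thesis
    proof (cases "E m c")
      case mc: False
      obtain l a where l: "a \<noteq> r" "E r l" "E a l" using cut by blast
      have bl: "b l = r" using br l by blast
      show ?thesis
      proof (cases "a = m")
        case True
        then have "flow_arc E Pr m r" using l mc bl bd dist by (intro flow_arcI[of m l]) (auto simp: Pr)
        then show ?thesis using ins1[of m c r] mc bc free by blast
      next
        case False
        then have an: "E n l" using l rows by metis
        show ?thesis
        proof (cases "l = c")
          case True then show ?thesis using ins1[of m c n] mc an free mn by blast
        next
          case False
          have "flow_arc E Pr n r" using outn[of l r] an l bl bd dist by auto
          then show ?thesis using ins2[of m c r Pr n] mc bc free mn by blast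
        qed
      qed
    next
      case mc: True
      have rm: "flow_arc E Pr r m" using mc bc free dist by (intro flow_arcI[of r c]) auto
      obtain j where j: "\<not> E (b j) j" using miss mc nd by blast
      obtain a where a: "E a j" using column_nonempty by blast
      have aj: "(a, j) \<notin> Pr" using a j bc bd by (auto simp: Pr)
      have "b j \<noteq> n" using upn a j by metis
      then have "b j = m \<and> a = n \<or> b j = r \<and> (a = m \<or> a = n)" using a j rows upm by metis
      then have "insertable E Pr (b j) j" using j a aj mn rm ins1 ins2 by metis
      then show ?thesis by blast
    qed
  qed
qed

text \<open>The edge \<open>(q, c)\<close> is protected only while \<open>q\<close> has mass in
  another column with parent \<open>r\<close>. Otherwise it is the only edge through which
  \<open>q\<close> emits wanted mass, and it survives because \<open>q\<close> must keep such an
  edge.\<close>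

lemma step_star:
  assumes rows: "\<And>i. i = p \<or> i = q \<or> i = r" and dist: "p \<noteq> q" "p \<noteq> r" "q \<noteq> r"
    and bc: "b c = r" "E r c"
    and upp: "\<And>j a. b j = p \<Longrightarrow> E a j \<Longrightarrow> a = p" and upq: "\<And>j. b j = q \<Longrightarrow> \<not> E r j"
    and out: "\<exists>j. b j \<noteq> q \<and> E q j"
    and Pr: "Pr = {(b j, j) | j. j \<noteq> c} \<union> {(p, c)} \<union> {(q, c) | j. j \<noteq> c \<and> b j = r \<and> E q j}"
    and miss: "(\<exists>j. \<not> E (b j) j) \<or> \<not> E p c \<or> \<not> E q c"
  shows "(\<exists>j. insertable E Pr (b j) j) \<or> insertable E Pr p c \<or> insertable E Pr q c"
proof -
  have free: "(r, c) \<notin> Pr" using dist by (auto simp: Pr)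
  have outp: "flow_arc E Pr p a" if "E p l" "E a l" "l \<noteq> c" "a \<noteq> p" for l a
    using that upp dist by (intro flow_arcI[of p l]) (auto simp: Pr)
  have br: "b l = r" if "E r l" for l using that rows upp upq dist by metis
  have rq: "flow_arc E Pr r q" if "E q c" using that bc free dist by (intro flow_arcI[of r c]) auto
  have rp: "flow_arc E Pr r p" if "E p c" using that bc free dist by (intro flow_arcI[of r c]) auto
  show ?thesis
  proof (cases "\<exists>j. j \<noteq> c \<and> b j = r \<and> E q j")
    case False
    obtain j where j: "b j \<noteq> q" "E q j" using out by blast
    then have "b j = r" using upp rows dist by metis
    then have qc: "E q c" using j False by metis
    have qfree: "(q, c) \<notin> Pr" using False dist bc by (auto simp: Pr)
    have qr: "flow_arc E Pr q r" using qfree qc bc dist by (intro flow_arcI[of q c]) auto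
    show ?thesis
    proof (cases "E p c")
      case True
      have qp: "flow_arc E Pr q p" using qfree qc True dist by (intro flow_arcI[of q c]) auto
      obtain j where j: "\<not> E (b j) j" using miss qc True by blast
      obtain a where a: "E a j" using column_nonempty by blast
      have aj: "(a, j) \<notin> Pr" using a j bc by (auto simp: Pr)
      have "b j \<noteq> p" using upp a j by metis
      then have "b j = q \<and> a = p \<or> b j = r \<and> (a = p \<or> a = q)" using a j rows upq by metis
      then have "insertable E Pr (b j) j" using j a aj qp qc rq rp True ins1 by metis
      then show ?thesis by blast
    next
      case pc: False
      obtain l a where l: "a \<noteq> p" "E p l" "E a l" using cut by blast
      then have "flow_arc E Pr p a" using outp pc by blast
      moreover have "a = q \<or> a = r" using l rows by blast
      ultimately show ?thesis using ins1[of p c] pc qc bc free qfree by metis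
    qed
  next
    case True
    then obtain j0 where j0: "j0 \<noteq> c" "b j0 = r" "E q j0" by blast
    have q0: "(q, j0) \<notin> Pr" using j0 dist by (auto simp: Pr)
    show ?thesis
    proof (cases "E q c")
      case True
      have "\<not> E r j0" using no_square[of q c r j0] True bc j0 dist by auto
      then show ?thesis using ins1[of r j0 q] rq[OF True] j0 q0 by metis
    next
      case qc: False
      have ins_qc: ?thesis if "flow_arc E Pr q r" using that ins1[of q c r] qc bc free by blast
      show ?thesis
      proof (cases "E r j0")
        case True
        then have "flow_arc E Pr q r" using j0 q0 dist by (intro flow_arcI[of q j0]) auto
        then show ?thesis by (rule ins_qc)
      next
        case rj0: False
        obtain k a where k: "a \<noteq> q" "E q k" "E a k" using cut by blast
        have kc: "k \<noteq> c" using k qc by blast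
        show ?thesis
        proof (cases "a = r")
          case True
          then have "flow_arc E Pr q r" using k kc br[of k] dist by (intro flow_arcI[of q k]) (auto simp: Pr)
          then show ?thesis by (rule ins_qc)
        next
          case False
          then have pk: "E p k" using k rows by metis
          have pq: "flow_arc E Pr p q" using outp[of k q] pk k kc dist by blast
          obtain l a' where l: "a' \<noteq> r" "E r l" "E a' l" using cut by blast
          have bl: "b l = r" using br l by blast
          show ?thesis
          proof (cases "a' = q")
            case True
            then have "l \<noteq> c" using l qc by blast
            then have "flow_arc E Pr q r" using l True bl dist by (intro flow_arcI[of q l]) (auto simp: Pr)
            then show ?thesis by (rule ins_qc)
          next
            case False
            then have pl: "E p l" using l rows by metis
            show ?thesis
            proof (cases "l = c")
              case True
              then have "flow_arc E Pr r p" using rp pl by blast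
              then show ?thesis using ins2[of r j0 q Pr p] pq j0 q0 rj0 by metis
            next
              case False
              have pr: "flow_arc E Pr p r" using outp[of l r] pl l False dist by blast
              have "\<not> E p c" using no_square[of p c r l] pl l bc False dist by auto
              then show ?thesis using ins1[of p c r] pr bc free by blast
            qed
          qed
        qed
      qed
    qed
  qed
qed

end

section \<open>Vertices, edges and pivots\<close>

definition circulation :: "real ^ 'n ^ 'm \<Rightarrow> bool" where
  "circulation D \<longleftrightarrow> (\<forall>i. (\<Sum>j\<in>UNIV. D $ i $ j) = 0) \<and> (\<forall>j. (\<Sum>i\<in>UNIV. D $ i $ j) = 0)"

definition support :: "real ^ 'n ^ 'm \<Rightarrow> ('m \<times> 'n) set" where
  "support x = {(i, j). x $ i $ j \<noteq> 0}"

lemma mem_support [simp]: "(i, j) \<in> support x \<longleftrightarrow> x $ i $ j \<noteq> 0"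
  by (simp add: support_def)

lemma circulation_simps [simp]:
  "circulation 0" "circulation D \<Longrightarrow> circulation (c *\<^sub>R D)" "circulation D \<Longrightarrow> circulation (- D)"
  "circulation D \<Longrightarrow> circulation D' \<Longrightarrow> circulation (D + D')"
  "circulation D \<Longrightarrow> circulation D' \<Longrightarrow> circulation (D - D')"
  by (auto simp: circulation_def sum.distrib sum_subtractf sum_negf simp flip: sum_distrib_left)

lemma transportation_polytopeD:
  assumes "x \<in> transportation_polytope u v"
  shows "(\<Sum>j\<in>UNIV. x $ i $ j) = u $ i" "(\<Sum>i\<in>UNIV. x $ i $ j) = v $ j" "x $ i $ j \<ge> 0"
  using assms by (auto simp: transportation_polytope_def)

lemma transportation_polytope_pos:
  "x \<in> transportation_polytope u v \<Longrightarrow> x $ i $ j \<noteq> 0 \<longleftrightarrow> x $ i $ j > 0"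
  using transportation_polytopeD(3)[of x u v i j] by auto

lemma circulation_diff:
  "x \<in> transportation_polytope u v \<Longrightarrow> y \<in> transportation_polytope u v \<Longrightarrow> circulation (y - x)"
  by (auto simp: transportation_polytope_def circulation_def sum_subtractf)

lemma transportation_polytope_add:
  "x \<in> transportation_polytope u v \<Longrightarrow> circulation D \<Longrightarrow> (\<And>i j. x $ i $ j + D $ i $ j \<ge> 0) \<Longrightarrow>
     x + D \<in> transportation_polytope u v"
  by (auto simp: transportation_polytope_def circulation_def sum.distrib)

lemma convex_transportation_polytope: "convex (transportation_polytope u v)"
  unfolding convex_alt by (auto simp: transportation_polytope_def sum.distrib simp flip: sum_distrib_left)
    (simp_all add: algebra_simps)

text \<open>A nonzero circulation inside the support could be followed a little way in both
  directions, which would place \<open>x\<close> inside a segment of the polytope.\<close>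

lemma vertex_circulation_zero:
  fixes x :: "real ^ 'n ^ 'm"
  assumes x: "x extreme_point_of transportation_polytope u v"
    and D: "circulation D" "support D \<subseteq> support x"
  shows "D = 0"
proof (rule ccontr)
  assume "D \<noteq> 0"
  let ?P = "transportation_polytope u v"
  have xP: "x \<in> ?P" using x by (simp add: extreme_point_of_def)
  let ?Q = "\<lambda>e. \<forall>i j. e * \<bar>D $ i $ j\<bar> \<le> x $ i $ j"
  have "\<exists>e>0. e * \<bar>D $ i $ j\<bar> \<le> x $ i $ j" for i j
  proof (cases "D $ i $ j = 0")
    case True
    then show ?thesis using transportation_polytopeD(3)[OF xP] by (intro exI[of _ 1]) auto
  next
    case False
    then have "x $ i $ j > 0"
      using D(2) transportation_polytope_pos[OF xP] by (auto simp: support_def)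
    then show ?thesis using False by (intro exI[of _ "x $ i $ j / \<bar>D $ i $ j\<bar>"]) auto
  qed
  then obtain e where e: "\<And>i j. e i j > 0" "\<And>i j. e i j * \<bar>D $ i $ j\<bar> \<le> x $ i $ j" by metis
  define d where "d = Min (range (\<lambda>(i, j). e i j))"
  have d0: "d > 0" using e by (auto simp: d_def)
  have "d \<le> e i j" for i j unfolding d_def by (rule Min_le) (auto intro: image_eqI[of _ _ "(i, j)"])
  then have "d * \<bar>D $ i $ j\<bar> \<le> x $ i $ j" for i j
    using e(2)[of i j] by (meson abs_ge_zero mult_right_mono order_trans)
  then have bound: "\<bar>d * D $ i $ j\<bar> \<le> x $ i $ j" for i j using d0 by (simp add: abs_mult)
  have nn: "x $ i $ j + d * D $ i $ j \<ge> 0" "x $ i $ j + (- d) * D $ i $ j \<ge> 0" for i j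
    using bound[of i j] by (simp_all add: abs_le_iff)
  have "x + d *\<^sub>R D \<in> ?P" "x + (- d) *\<^sub>R D \<in> ?P"
    using nn by (intro transportation_polytope_add[OF xP] circulation_simps D; simp)+
  moreover have "x \<in> open_segment (x + d *\<^sub>R D) (x + (- d) *\<^sub>R D)"
    using \<open>D \<noteq> 0\<close> d0 by (auto simp: in_segment algebra_simps intro!: exI[of _ "1/2"] simp flip: scaleR_add_left)
  ultimately show False using x by (auto simp: extreme_point_of_def)
qed

lemma vertexI:
  fixes x :: "real ^ 'n ^ 'm"
  assumes xP: "x \<in> transportation_polytope u v"
    and D: "\<And>D. circulation D \<Longrightarrow> support D \<subseteq> support x \<Longrightarrow> D = 0"
  shows "x extreme_point_of transportation_polytope u v"
  unfolding extreme_point_of_def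
proof (intro conjI ballI xP notI)
  fix a b assume ab: "a \<in> transportation_polytope u v" "b \<in> transportation_polytope u v"
    and seg: "x \<in> open_segment a b"
  obtain t where t: "0 < t" "t < 1" "x = (1 - t) *\<^sub>R a + t *\<^sub>R b" "a \<noteq> b"
    using seg by (auto simp: in_segment)
  have "support (b - a) \<subseteq> support x"
  proof
    fix e assume e: "e \<in> support (b - a)"
    obtain i j where [simp]: "e = (i, j)" by (cases e)
    have "a $ i $ j \<ge> 0" "b $ i $ j \<ge> 0" "a $ i $ j \<noteq> b $ i $ j"
      using ab transportation_polytopeD(3) e by auto
    then have "(1 - t) * a $ i $ j + t * b $ i $ j > 0"
      using t by (cases "a $ i $ j = 0") (auto intro: add_pos_nonneg)
    then show "e \<in> support x" using t by simp
  qed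
  then have "b - a = 0" using D[of "b - a"] circulation_diff ab by blast
  then show False using t by simp
qed

lemma vertex_eqI:
  assumes "x extreme_point_of transportation_polytope u v" "z \<in> transportation_polytope u v"
    and "support z \<subseteq> support x"
  shows "z = x"
proof -
  have "x \<in> transportation_polytope u v" using assms by (simp add: extreme_point_of_def)
  moreover have "support (z - x) \<subseteq> support x" using assms(3) by (auto simp: support_def subset_iff)
  ultimately have "z - x = 0" using vertex_circulation_zero[OF assms(1)] circulation_diff assms by blast
  then show ?thesis by simp
qed

text \<open>Two supports span at most one cycle; for vertices this means equal or adjacent.\<close>

definition pivot :: "('m::finite \<times> 'n::finite) set \<Rightarrow> ('m \<times> 'n) set \<Rightarrow> bool" where
  "pivot S S' \<longleftrightarrow> (\<exists>D :: real ^ 'n ^ 'm. circulation D \<and>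
     (\<forall>D'. circulation D' \<longrightarrow> support D' \<subseteq> S \<union> S' \<longrightarrow> (\<exists>c. D' = c *\<^sub>R D)))"

text \<open>The sets \<open>S\<close> and \<open>S'\<close> may exceed the supports because the
  pivot relation is inherited from perturbed vertices, whose limits can lose support
  entries.\<close>

lemma pivot_edge:
  fixes x y :: "real ^ 'n ^ 'm"
  assumes x: "x extreme_point_of transportation_polytope u v"
    and y: "y extreme_point_of transportation_polytope u v"
    and ne: "x \<noteq> y" and sub: "support x \<subseteq> S" "support y \<subseteq> S'" and piv: "pivot S S'"
  shows "closed_segment x y edge_of transportation_polytope u v"
proof -
  let ?P = "transportation_polytope u v"
  have xP: "x \<in> ?P" and yP: "y \<in> ?P" using x y by (auto simp: extreme_point_of_def)
  obtain D :: "real ^ 'n ^ 'm" where D: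
    "\<And>D'. circulation D' \<Longrightarrow> support D' \<subseteq> S \<union> S' \<Longrightarrow> \<exists>c. D' = c *\<^sub>R D"
    using piv by (auto simp: pivot_def)
  have "support (y - x) \<subseteq> S \<union> S'" using sub by (force simp: support_def)
  then obtain c where c: "y - x = c *\<^sub>R D" using D circulation_diff xP yP by blast
  then have c0: "c \<noteq> 0" using ne by auto
  \<comment> \<open>Circulations on the union of the supports are multiples of \<open>y - x\<close>,
    so the candidate face lies on a line; extremality of \<open>x\<close> and \<open>y\<close> then
    cuts this line down to the segment.\<close>
  have line: "\<exists>t. a = x + t *\<^sub>R (y - x)" if a: "a \<in> ?P" "support a \<subseteq> support x \<union> support y" for a
  proof -
    have "support (a - x) \<subseteq> S \<union> S'" using a(2) sub by (force simp: support_def)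
    then obtain c' where "a - x = c' *\<^sub>R D" using D circulation_diff xP a by blast
    then have "a - x = (c' / c) *\<^sub>R (y - x)" using c c0 by simp
    then show ?thesis by (metis add.commute diff_add_cancel)
  qed
  have in_seg: "a \<in> closed_segment x y" if a: "a \<in> ?P" "support a \<subseteq> support x \<union> support y" for a
  proof -
    obtain t where t: "a = x + t *\<^sub>R (y - x)" using line[OF a] by blast
    have "t \<ge> 0"
    proof (rule ccontr)
      assume "\<not> t \<ge> 0"
      define s where "s = - t / (1 - t)"
      have s: "0 < s" "s < 1" "(1 - s) * t + s = 0" using \<open>\<not> t \<ge> 0\<close> by (auto simp: s_def field_simps)
      have "(1 - s) *\<^sub>R a + s *\<^sub>R y = x + ((1 - s) * t + s) *\<^sub>R (y - x)" 
        by (simp add: t algebra_simps)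
      then have "x = (1 - s) *\<^sub>R a + s *\<^sub>R y" using s by simp
      moreover have "a \<noteq> y"
      proof
        assume "a = y"
        then have "(t - 1) *\<^sub>R (y - x) = 0" using t by (simp add: algebra_simps)
        then show False using ne \<open>\<not> t \<ge> 0\<close> by simp
      qed
      ultimately have "x \<in> open_segment a y" using s by (auto simp: in_segment)
      then show False using x a yP by (auto simp: extreme_point_of_def)
    qed
    moreover have "t \<le> 1"
    proof (rule ccontr)
      assume t1: "\<not> t \<le> 1"
      define s where "s = 1 / t"
      have s: "0 < s" "s < 1" "s * t = 1" using t1 by (auto simp: s_def)
      have "(1 - s) *\<^sub>R x + s *\<^sub>R a = x + (s * t) *\<^sub>R (y - x)"
        by (simp add: t algebra_simps)
      then have "y = (1 - s) *\<^sub>R x + s *\<^sub>R a" using s by simp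
      moreover have "x \<noteq> a" using t ne t1 by auto
      ultimately have "y \<in> open_segment x a" using s by (auto simp: in_segment)
      then show False using y a xP by (auto simp: extreme_point_of_def)
    qed
    ultimately show ?thesis using t by (auto simp: in_segment algebra_simps intro!: exI[of _ t])
  qed
  have "closed_segment x y face_of ?P"
    unfolding face_of_def
  proof (intro conjI ballI impI)
    show "closed_segment x y \<subseteq> ?P"
      using xP yP by (intro closed_segment_subset convex_transportation_polytope)
    show "convex (closed_segment x y)" by simp
    fix a b z assume ab: "a \<in> ?P" "b \<in> ?P" and z: "z \<in> closed_segment x y" "z \<in> open_segment a b"
    have zs: "support z \<subseteq> support x \<union> support y" using z(1) by (force simp: in_segment support_def)
    obtain t where t: "0 < t" "t < 1" "z = (1 - t) *\<^sub>R a + t *\<^sub>R b" using z(2) by (auto simp: in_segment)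
    have "support a \<subseteq> support z \<and> support b \<subseteq> support z"
    proof -
      have "z $ i $ j > 0" if "a $ i $ j \<noteq> 0 \<or> b $ i $ j \<noteq> 0" for i j
      proof -
        have "a $ i $ j \<ge> 0" "b $ i $ j \<ge> 0" using ab[THEN transportation_polytopeD(3)] by auto
        then have "(1 - t) * a $ i $ j + t * b $ i $ j > 0"
          using t that by (cases "a $ i $ j = 0") (auto intro: add_pos_nonneg)
        then show ?thesis using t by simp
      qed
      then show ?thesis by (force simp: support_def)
    qed
    then show "a \<in> closed_segment x y" "b \<in> closed_segment x y" using in_seg ab zs by blast+
  qed
  then show ?thesis using ne by (simp add: edge_of_def segment_convex_hull aff_dim_convex_hull aff_dim_2)
qed

section \<open>Pivots along a circulation\<close>

lemma move_along:
  fixes x D :: "real ^ 'n ^ 'm"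
  assumes x: "x extreme_point_of transportation_polytope u v"
    and D: "circulation D" "D $ s $ j > 0" "x $ s $ j = 0" "support D \<subseteq> insert (s, j) (support x)"
  obtains d where "d > 0" "x + d *\<^sub>R D extreme_point_of transportation_polytope u v"
    "pivot (support x) (support (x + d *\<^sub>R D))"
proof -
  let ?P = "transportation_polytope u v"
  have xP: "x \<in> ?P" using x by (simp add: extreme_point_of_def)
  define N where "N = {(i, k). D $ i $ k < 0}"
  have "\<exists>i. D $ i $ j < 0"
  proof (rule ccontr)
    assume "\<not> ?thesis"
    then have "(\<Sum>i\<in>UNIV. D $ i $ j) > 0" using D(2) by (intro sum_pos2[of _ s]) (auto simp: not_less)
    then show False using D(1) by (auto simp: circulation_def)
  qed
  then have N: "N \<noteq> {}" "finite N" by (auto simp: N_def)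
  define g where "g = (\<lambda>(i, k). x $ i $ k / (- D $ i $ k))"
  \<comment> \<open>Ratio test: \<open>d\<close> is the largest step that keeps all entries
    nonnegative. The entry \<open>(i0, k0)\<close> attaining the minimum drops to zero, and this is
    what makes the new point a vertex.\<close>
  define d where "d = Min (g ` N)"
  have "d \<in> g ` N" using N by (auto simp: d_def)
  then obtain i0 k0 where 0: "D $ i0 $ k0 < 0" "d = x $ i0 $ k0 / (- D $ i0 $ k0)"
    by (auto simp: N_def g_def)
  have "(i0, k0) \<noteq> (s, j)" using 0 D by auto
  moreover have "(i0, k0) \<in> support D" using 0 by simp
  ultimately have "x $ i0 $ k0 \<noteq> 0" using D(4) mem_support by blast
  then have "x $ i0 $ k0 > 0" using transportation_polytope_pos[OF xP] by blast
  then have d0: "d > 0" unfolding 0(2) using 0(1) by (intro divide_pos_pos) auto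
  have le: "x $ i $ k + d * D $ i $ k \<ge> 0" for i k
  proof (cases "D $ i $ k < 0")
    case True
    then have "(i, k) \<in> N" by (simp add: N_def)
    then have "d \<le> g (i, k)" unfolding d_def using N by (intro Min_le) auto
    then show ?thesis using True by (simp add: g_def field_simps)
  next
    case False
    then show ?thesis using d0 transportation_polytopeD(3)[OF xP] by (simp add: not_less)
  qed
  define x' where "x' = x + d *\<^sub>R D"
  have x'P: "x' \<in> ?P" unfolding x'_def using le D by (intro transportation_polytope_add xP) auto
  have x'0: "x' $ i0 $ k0 = 0" using 0 by (simp add: x'_def)
  have x's: "support x' \<subseteq> insert (s, j) (support x)"
    using D(4) by (force simp: support_def x'_def)
  \<comment> \<open>Subtracting the multiple of \<open>D\<close> that agrees at
    \<open>(s, j)\<close> leaves a circulation inside the support of the vertex \<open>x\<close>,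
    which must vanish.\<close>
  have multiple: "D' = (D' $ s $ j / D $ s $ j) *\<^sub>R D"
    if D': "circulation D'" "support D' \<subseteq> insert (s, j) (support x)" for D'
  proof -
    have sub: "support (D' - (D' $ s $ j / D $ s $ j) *\<^sub>R D) \<subseteq> support x"
    proof
      fix e assume e: "e \<in> support (D' - (D' $ s $ j / D $ s $ j) *\<^sub>R D)"
      obtain i k where [simp]: "e = (i, k)" by (cases e)
      have "(i, k) \<noteq> (s, j)" using e D(2) by auto
      moreover have "D' $ i $ k \<noteq> 0 \<or> D $ i $ k \<noteq> 0" using e by auto
      ultimately show "e \<in> support x" using D(4) D'(2) by (auto simp: support_def)
    qed
    have "D' - (D' $ s $ j / D $ s $ j) *\<^sub>R D = 0"
      by (rule vertex_circulation_zero[OF x _ sub]) (use D(1) D'(1) in simp)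
    then show ?thesis by simp
  qed
  have "x' extreme_point_of ?P"
  proof (rule vertexI[OF x'P])
    fix D' :: "real ^ 'n ^ 'm" assume D': "circulation D'" "support D' \<subseteq> support x'"
    let ?c = "D' $ s $ j / D $ s $ j"
    have m: "D' = ?c *\<^sub>R D" using multiple D' x's by blast
    have "(i0, k0) \<notin> support D'" using D'(2) x'0 mem_support by blast
    then have "D' $ i0 $ k0 = 0" by simp
    then have "?c * D $ i0 $ k0 = 0" using m by (metis vector_scaleR_component real_scaleR_def)
    then have "?c = 0" using 0 by simp
    then show "D' = 0" using m by (metis scaleR_zero_left)
  qed
  moreover have "pivot (support x) (support x')"
    unfolding pivot_def using multiple x's D(1) by (intro exI[of _ D]) blast
  ultimately show thesis using that d0 by (simp add: x'_def)
qed

definition transfer :: "'n::finite \<Rightarrow> 'm::finite \<Rightarrow> 'm \<Rightarrow> real ^ 'n ^ 'm" where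
  "transfer k a b = (\<chi> i l. if l = k then of_bool (i = b) - of_bool (i = a) else 0)"

lemma transfer_sums:
  "(\<Sum>l\<in>UNIV. transfer k a b $ i $ l) = of_bool (i = b) - of_bool (i = a)"
  "(\<Sum>i\<in>UNIV. transfer k a b $ i $ l) = 0"
  by (cases "l = k"; simp add: transfer_def sum_subtractf of_bool_def)+

text \<open>The circulation is a sum of transfers, one in column \<open>j\<close> from the drained
  row to \<open>s\<close> and one for each arc. Its negative entries sit at unprotected edges, so
  protected edges never lose mass.\<close>

lemma insert_step:
  fixes x :: "real ^ 'n ^ 'm"
  assumes x: "x extreme_point_of transportation_polytope u v"
    and ins: "insertable (\<lambda>i j. x $ i $ j \<noteq> 0) Pr s j"
  obtains x' where "x' extreme_point_of transportation_polytope u v"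
    "pivot (support x) (support x')" "x' $ s $ j \<noteq> 0"
    "support x' \<subseteq> insert (s, j) (support x)" "Pr \<inter> support x \<subseteq> support x'"
proof -
  note found = that
  have xP: "x \<in> transportation_polytope u v" using x by (simp add: extreme_point_of_def)
  have goal: thesis if D: "circulation D" "D $ s $ j = 1" "support D \<subseteq> insert (s, j) (support x)"
    "\<And>e. e \<in> Pr \<Longrightarrow> D $ fst e $ snd e \<ge> 0" for D
  proof -
    have xs: "x $ s $ j = 0" using ins by (simp add: insertable_def)
    obtain d where d: "d > 0" "x + d *\<^sub>R D extreme_point_of transportation_polytope u v"
      "pivot (support x) (support (x + d *\<^sub>R D))"
      using move_along[OF x D(1) _ xs D(3)] D(2) by auto
    show thesis
    proof (rule found[OF d(2,3)])
      show "(x + d *\<^sub>R D) $ s $ j \<noteq> 0" using d D xs by simp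
      show "support (x + d *\<^sub>R D) \<subseteq> insert (s, j) (support x)"
        using D(3) by (force simp: support_def)
      show "Pr \<inter> support x \<subseteq> support (x + d *\<^sub>R D)"
      proof
        fix e assume e: "e \<in> Pr \<inter> support x"
        obtain i k where [simp]: "e = (i, k)" by (cases e)
        have "x $ i $ k > 0" using e transportation_polytope_pos[OF xP] by auto
        moreover have "d * D $ i $ k \<ge> 0" using e D(4)[of e] d by auto
        ultimately have "x $ i $ k + d * D $ i $ k > 0" by simp
        then show "e \<in> support (x + d *\<^sub>R D)" by simp
      qed
    qed
  qed
  have xs: "x $ s $ j = 0" using ins by (simp add: insertable_def)
  have short: thesis
    if h: "x $ a $ j \<noteq> 0" "(a, j) \<notin> Pr" "x $ s $ k \<noteq> 0" "x $ a $ k \<noteq> 0" "(s, k) \<notin> Pr" "s \<noteq> a" for a k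
  proof (rule goal)
    have jk: "j \<noteq> k" using xs h by auto
    let ?D = "transfer j a s + transfer k s a"
    show "circulation ?D" by (simp add: circulation_def sum.distrib transfer_sums)
    show "?D $ s $ j = 1" using jk h by (simp add: transfer_def)
    show "support ?D \<subseteq> insert (s, j) (support x)"
      using h jk by (auto simp: support_def transfer_def of_bool_def split: if_splits)
    show "?D $ fst e $ snd e \<ge> 0" if "e \<in> Pr" for e
      using that h jk by (cases e) (auto simp: transfer_def)
  qed
  obtain a where a: "x $ a $ j \<noteq> 0" "(a, j) \<notin> Pr"
    "flow_arc (\<lambda>i j. x $ i $ j \<noteq> 0) Pr s a \<or>
      (\<exists>m. flow_arc (\<lambda>i j. x $ i $ j \<noteq> 0) Pr s m \<and> flow_arc (\<lambda>i j. x $ i $ j \<noteq> 0) Pr m a)"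
    using ins by (auto simp: insertable_def)
  from a(3) show thesis
  proof (elim disjE exE conjE)
    assume "flow_arc (\<lambda>i j. x $ i $ j \<noteq> 0) Pr s a"
    then show thesis using short a by (auto simp: flow_arc_def)
  next
    fix m assume "flow_arc (\<lambda>i j. x $ i $ j \<noteq> 0) Pr s m" "flow_arc (\<lambda>i j. x $ i $ j \<noteq> 0) Pr m a"
    then obtain k l where kl: "s \<noteq> m" "x $ s $ k \<noteq> 0" "x $ m $ k \<noteq> 0" "(s, k) \<notin> Pr"
      "m \<noteq> a" "x $ m $ l \<noteq> 0" "x $ a $ l \<noteq> 0" "(m, l) \<notin> Pr" by (auto simp: flow_arc_def)
    have sa: "s \<noteq> a" using a xs by auto
    have kj: "k \<noteq> j" using kl xs by auto
    show thesis
    \<comment> \<open>A repeated column shortens the cycle: for \<open>l = j\<close> the edge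
      \<open>(m, j)\<close> is drained instead, and for \<open>l = k\<close> one arc leads directly
      from \<open>s\<close> to \<open>a\<close>.\<close>
    proof (cases "l = j \<or> l = k")
      case True
      then show thesis using short[of m k] short[of a k] a kl sa by auto
    next
      case False
      show thesis
      proof (rule goal)
        let ?D = "transfer j a s + transfer k s m + transfer l m a"
        show "circulation ?D" by (simp add: circulation_def sum.distrib transfer_sums)
        show "?D $ s $ j = 1" using kj False sa by (auto simp: transfer_def)
        show "support ?D \<subseteq> insert (s, j) (support x)"
          using a kl sa kj False by (auto simp: support_def transfer_def of_bool_def split: if_splits)
        show "?D $ fst e $ snd e \<ge> 0" if "e \<in> Pr" for e
          using that a kl sa kj False by (cases e) (auto simp: transfer_def)
      qed
    qed
  qed
qed

text \<open>Nondegeneracy. The full row set has to be excluded, since it balances the full column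
  set.\<close>

definition generic :: "real ^ 'm \<Rightarrow> real ^ 'n \<Rightarrow> bool" where
  "generic u v \<longleftrightarrow> (\<forall>A B. A \<noteq> {} \<longrightarrow> A \<noteq> UNIV \<longrightarrow> (\<Sum>i\<in>A. u $ i) \<noteq> (\<Sum>j\<in>B. v $ j))"

text \<open>A row sharing no column would balance exactly its own columns, against genericity; a
  square or hexagon would carry a nonzero circulation on the support.\<close>

lemma vertex_tree_support:
  fixes x :: "real ^ 'n ^ 'm"
  assumes x: "x extreme_point_of transportation_polytope u v"
    and gen: "generic u v" and v: "\<And>j. v $ j > 0" and card: "CARD('m) \<ge> 2"
  shows "tree_support (\<lambda>i j. x $ i $ j \<noteq> 0)"
proof
  have xP: "x \<in> transportation_polytope u v" using x by (simp add: extreme_point_of_def)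
  show "\<exists>k m. m \<noteq> i \<and> x $ i $ k \<noteq> 0 \<and> x $ m $ k \<noteq> 0" for i
  proof (rule ccontr)
    assume no: "\<not> ?thesis"
    define B where "B = {j. x $ i $ j \<noteq> 0}"
    have "v $ j = x $ i $ j" if "j \<in> B" for j
    proof -
      have "(\<Sum>a\<in>UNIV. x $ a $ j) = (\<Sum>a\<in>{i}. x $ a $ j)"
        using no that by (intro sum.mono_neutral_right) (auto simp: B_def)
      then show ?thesis using transportation_polytopeD(2)[OF xP] by simp
    qed
    then have "(\<Sum>j\<in>B. v $ j) = (\<Sum>j\<in>B. x $ i $ j)" by simp
    also have "\<dots> = (\<Sum>j\<in>UNIV. x $ i $ j)" by (rule sum.mono_neutral_left) (auto simp: B_def)
    also have "\<dots> = (\<Sum>a\<in>{i}. u $ a)" using transportation_polytopeD(1)[OF xP] by simp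
    finally have "{i} = UNIV" using gen unfolding generic_def by (metis insert_not_empty)
    then have "CARD('m) = card {i}" by simp
    then show False using card by simp
  qed
  show "j = k" if h: "x $ a $ j \<noteq> 0" "x $ b $ j \<noteq> 0" "x $ a $ k \<noteq> 0" "x $ b $ k \<noteq> 0" "a \<noteq> b" for a b j k
  proof (rule ccontr)
    assume "j \<noteq> k"
    let ?D = "transfer j a b + transfer k b a"
    have "circulation ?D" by (simp add: circulation_def sum.distrib transfer_sums)
    moreover have "support ?D \<subseteq> support x"
      using h \<open>j \<noteq> k\<close> by (auto simp: support_def transfer_def of_bool_def split: if_splits)
    ultimately have "?D = 0" using vertex_circulation_zero[OF x] by blast
    then have "?D $ b $ j = 0" by (simp only: zero_index)
    then show False using h \<open>j \<noteq> k\<close> by (simp add: transfer_def)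
  qed
  show "j = k \<or> k = l \<or> j = l"
    if h: "x $ a $ j \<noteq> 0" "x $ b $ j \<noteq> 0" "x $ b $ k \<noteq> 0" "x $ c $ k \<noteq> 0" "x $ c $ l \<noteq> 0" "x $ a $ l \<noteq> 0"
      "a \<noteq> b" "b \<noteq> c" "a \<noteq> c" for a b c j k l
  proof (rule ccontr)
    assume ne: "\<not> ?thesis"
    let ?D = "transfer j a b + transfer k b c + transfer l c a"
    have "circulation ?D" by (simp add: circulation_def sum.distrib transfer_sums)
    moreover have "support ?D \<subseteq> support x"
      using h ne by (auto simp: support_def transfer_def of_bool_def split: if_splits)
    ultimately have "?D = 0" using vertex_circulation_zero[OF x] by blast
    then have "?D $ b $ j = 0" by (simp only: zero_index)
    then show False using h ne by (simp add: transfer_def)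
  qed
  show "\<exists>i. x $ i $ j \<noteq> 0" for j
  proof (rule ccontr)
    assume "\<not> ?thesis"
    then have "(\<Sum>i\<in>UNIV. x $ i $ j) = 0" by simp
    then show False using transportation_polytopeD(2)[OF xP, of j] v[of j] by simp
  qed
qed

section \<open>Walking to a fixed vertex\<close>

definition pivot_steps :: "real ^ 'm \<Rightarrow> real ^ 'n \<Rightarrow> (real ^ 'n ^ 'm) rel" where
  "pivot_steps u v = {(x, x'). x extreme_point_of transportation_polytope u v \<and>
     x' extreme_point_of transportation_polytope u v \<and> pivot (support x) (support x')}"

text \<open>The remaining potential \<open>f x'\<close> is kept in the bound so that consecutive
  phases can be added up.\<close>

lemma steps_until:
  fixes f :: "'a \<Rightarrow> nat"
  assumes "I x" and step: "\<And>x. I x \<Longrightarrow> \<not> G x \<Longrightarrow> \<exists>x'. I x' \<and> (x, x') \<in> R \<and> f x' < f x"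
  shows "\<exists>l x'. (x, x') \<in> R ^^ l \<and> I x' \<and> G x' \<and> l + f x' \<le> f x"
  using assms(1)
proof (induction "f x" arbitrary: x rule: less_induct)
  case less
  show ?case
  proof (cases "G x")
    case True
    then show ?thesis using less.prems by (intro exI[of _ 0] exI[of _ x]) auto
  next
    case False
    then obtain x' where x': "I x'" "(x, x') \<in> R" "f x' < f x" using step less.prems by blast
    then obtain l x'' where "(x', x'') \<in> R ^^ l" "I x''" "G x''" "l + f x'' \<le> f x'"
      using less.hyps by blast
    moreover from x'(2) this(1) have "(x, x'') \<in> R ^^ Suc l" by (rule relpow_Suc_I2)
    ultimately show ?thesis using x'(3) by (intro exI[of _ "Suc l"] exI[of _ x'']) simp
  qed
qed

lemma card_missing_less:
  fixes T T' :: "'a::finite set"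
  assumes "S \<inter> T \<subseteq> T'" "f \<in> S" "f \<notin> T" "f \<in> T'"
  shows "card (S - T') < card (S - T)"
  by (rule psubset_card_mono) (use assms in auto)

lemma rows_exhaust:
  assumes "p \<noteq> q" "p \<noteq> t" "q \<noteq> t"
  shows "i = p \<or> i = q \<or> i = (t :: 3)"
proof -
  have "card {p, q, t} = CARD(3)" using assms by simp
  then have "{p, q, t} = UNIV" by (intro card_subset_eq) auto
  then show ?thesis by blast
qed

text \<open>
  The support tree of the target vertex is rooted at a row \<open>r\<close> that has only one child column \<open>c\<close>
  which is not a leaf, and \<open>b j\<close> is the parent row of column \<open>j\<close>. The other two rows \<open>m\<close> and \<open>n\<close> are
  children of the columns \<open>c\<close> and \<open>d\<close>; the case \<open>c = d\<close> is that of a column meeting all three rows.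
\<close>

locale rooted_target =
  fixes u :: "real ^ 3" and v :: "real ^ 'n" and y :: "real ^ 'n ^ 3"
    and b :: "'n \<Rightarrow> 3" and r m n :: 3 and c d :: 'n
  assumes gen: "generic u v" and vpos: "\<And>j. v $ j > 0"
    and y: "y extreme_point_of transportation_polytope u v"
    and dist: "r \<noteq> m" "r \<noteq> n" "m \<noteq> n"
    and supp: "\<And>i j. y $ i $ j \<noteq> 0 \<longleftrightarrow> i = b j \<or> (i = m \<and> j = c) \<or> (i = n \<and> j = d)"
    and bc: "b c = r" and bd: "c \<noteq> d \<Longrightarrow> b d = m"
begin

abbreviation vertex :: "real ^ 'n ^ 3 \<Rightarrow> bool" where
  "vertex x \<equiv> x extreme_point_of transportation_polytope u v"

abbreviation edges :: "real ^ 'n ^ 3 \<Rightarrow> 3 \<Rightarrow> 'n \<Rightarrow> bool" where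
  "edges x \<equiv> \<lambda>i j. x $ i $ j \<noteq> 0"

abbreviation steps :: "(real ^ 'n ^ 3) rel" where "steps \<equiv> pivot_steps u v"

definition col :: "(3 \<times> 'n) set" where "col = {(b j, j) | j. True}"

text \<open>Draw an arrow from a row to the parent of each column it meets, ignoring loops. Then
  \<open>wants\<close> is an arrow, an \<open>all_in\<close> row has no outgoing arrow and an
  \<open>all_out\<close> row no incoming one.\<close>

definition all_in :: "real ^ 'n ^ 3 \<Rightarrow> 3 \<Rightarrow> bool" where
  "all_in x t \<longleftrightarrow> (\<forall>j. x $ t $ j \<noteq> 0 \<longrightarrow> b j = t)"

definition all_out :: "real ^ 'n ^ 3 \<Rightarrow> 3 \<Rightarrow> bool" where
  "all_out x q \<longleftrightarrow> (\<forall>j a. b j = q \<longrightarrow> x $ a $ j \<noteq> 0 \<longrightarrow> a = q)"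

definition wants :: "real ^ 'n ^ 3 \<Rightarrow> 3 \<Rightarrow> 3 \<Rightarrow> bool" where
  "wants x a t \<longleftrightarrow> (\<exists>j. b j = t \<and> x $ a $ j \<noteq> 0)"

section \<open>Comparison of row sums with the target\<close>

lemma in_polytope: "vertex x \<Longrightarrow> x \<in> transportation_polytope u v"
  by (simp add: extreme_point_of_def)

lemma tree: "vertex x \<Longrightarrow> tree_support (edges x)"
  by (rule vertex_tree_support[OF _ gen vpos]) auto

lemma nonneg: "vertex x \<Longrightarrow> x $ i $ j \<ge> 0"
  using in_polytope transportation_polytopeD by blast

lemma le_demand: "vertex x \<Longrightarrow> x $ i $ j \<le> v $ j"
proof -
  assume x: "vertex x"
  have "x $ i $ j \<le> (\<Sum>i\<in>UNIV. x $ i $ j)" using nonneg[OF x] by (intro member_le_sum) auto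
  then show ?thesis using in_polytope[OF x] transportation_polytopeD(2) by metis
qed

lemma eq_demand: "x $ i $ j = v $ j" if "vertex x" "\<And>a. a \<noteq> i \<Longrightarrow> x $ a $ j = 0"
proof -
  have "(\<Sum>a\<in>UNIV. x $ a $ j) = (\<Sum>a\<in>{i}. x $ a $ j)"
    using that by (intro sum.mono_neutral_right) auto
  then show ?thesis using in_polytope[OF that(1)] transportation_polytopeD(2)[of x u v j] by simp
qed

lemma less_demand: "x $ i $ j < v $ j" if "vertex x" "x $ a $ j \<noteq> 0" "a \<noteq> i"
proof -
  have "x $ i $ j + x $ a $ j = (\<Sum>a\<in>{i, a}. x $ a $ j)" using that by simp
  also have "\<dots> \<le> (\<Sum>a\<in>UNIV. x $ a $ j)" using nonneg[OF that(1)] by (intro sum_mono2) auto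
  also have "\<dots> = v $ j" using in_polytope[OF that(1)] transportation_polytopeD(2) by blast
  finally show ?thesis using that(2) nonneg[OF that(1), of a j] by simp
qed

lemma row_eqI:
  assumes "vertex x" "vertex z" and le: "\<And>j. x $ i $ j \<le> z $ i $ j"
  shows "x $ i $ j = z $ i $ j"
proof (rule ccontr)
  assume "\<not> ?thesis"
  then have "(\<Sum>j\<in>UNIV. x $ i $ j) < (\<Sum>j\<in>UNIV. z $ i $ j)"
    using le by (intro sum_strict_mono_ex1) (auto simp: less_le)
  then show False
    using in_polytope[OF assms(1), THEN transportation_polytopeD(1), of i]
      in_polytope[OF assms(2), THEN transportation_polytopeD(1), of i] by simp
qed

lemma leaf_full: "y $ b j $ j = v $ j" if "j \<noteq> c" "j \<noteq> d"
  by (rule eq_demand[OF y]) (use that supp in auto)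

text \<open>The target saturates the leaf columns of row \<open>i\<close>. If \<open>x\<close> used
  only those, its row would be dominated by that of \<open>y\<close> and hence equal to it, although
  \<open>y\<close> also has mass at the parent column \<open>k\<close>.\<close>

lemma out_exists:
  assumes x: "vertex x" and k: "y $ i $ k \<noteq> 0" "b k \<noteq> i" and leaf: "\<And>j. b j = i \<Longrightarrow> j \<noteq> c \<and> j \<noteq> d"
  shows "\<not> all_in x i"
proof
  assume a: "all_in x i"
  have "b j \<noteq> i \<Longrightarrow> x $ i $ j = 0" for j using a by (auto simp: all_in_def)
  then have "x $ i $ j \<le> y $ i $ j" for j
    using leaf[of j] leaf_full[of j] le_demand[OF x, of i j] nonneg[OF y, of i j]
    by (cases "b j = i") auto
  then have "x $ i $ k = y $ i $ k" by (rule row_eqI[OF x y])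
  then show False using k a by (auto simp: all_in_def)
qed

lemma not_all_in_n: "vertex x \<Longrightarrow> \<not> all_in x n"
  by (rule out_exists[of x n d]) (use supp bc bd dist in auto)

lemma not_all_in_m: "vertex x \<Longrightarrow> c = d \<Longrightarrow> \<not> all_in x m"
  by (rule out_exists[of x m c]) (use supp bc bd dist in auto)

text \<open>The root has no parent column. If it filled all its child columns it would dominate the
  target row, yet the target shares column \<open>c\<close> with row \<open>m\<close>.\<close>

lemma not_all_out_r: "\<not> all_out x r" if x: "vertex x"
proof
  assume a: "all_out x r"
  have full: "x $ r $ j = v $ j" if "b j = r" for j
    using a that by (intro eq_demand[OF x]) (auto simp: all_out_def)
  have "y $ r $ j \<le> x $ r $ j" for j
    using full le_demand[OF y, of r j] nonneg[OF x, of r j] supp[of r j] dist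
    by (cases "b j = r") auto
  then have "y $ r $ c = x $ r $ c" by (rule row_eqI[OF y x])
  then show False using full bc less_demand[OF y, of m c r] supp dist by auto
qed

text \<open>All children of \<open>t\<close> other than \<open>k\<close> are leaves, which
  \<open>y\<close> saturates. Without \<open>(t, k)\<close> the row of \<open>x\<close> would lie
  below the target row and so equal it, but \<open>y\<close> is positive at
  \<open>(t, k)\<close>.\<close>

lemma all_in_present:
  assumes x: "vertex x" and t: "all_in x t" and k: "b k = t"
    and leaf: "\<And>j. b j = t \<Longrightarrow> j \<noteq> k \<Longrightarrow> j \<noteq> c \<and> j \<noteq> d"
  shows "x $ t $ k \<noteq> 0"
proof
  assume 0: "x $ t $ k = 0"
  have "b j \<noteq> t \<Longrightarrow> x $ t $ j = 0" for j using t by (auto simp: all_in_def)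
  then have "x $ t $ j \<le> y $ t $ j" for j
    using leaf[of j] leaf_full[of j] le_demand[OF x, of t j] nonneg[OF y, of t j] 0
    by (cases "b j = t"; cases "j = k") auto
  then have "x $ t $ k = y $ t $ k" by (rule row_eqI[OF x y])
  then show False using 0 k supp by auto
qed

text \<open>If \<open>q\<close> filled its parent column \<open>k\<close> as well as its children,
  its row would dominate the target row and so equal it, but in \<open>y\<close> the parent
  \<open>b k\<close> also takes a share of column \<open>k\<close>.\<close>

lemma all_out_present:
  assumes x: "vertex x" and q: "all_out x q" and k: "b k \<noteq> q"
    and uniq: "\<And>j. y $ q $ j \<noteq> 0 \<Longrightarrow> b j \<noteq> q \<Longrightarrow> j = k"
  shows "\<exists>a. a \<noteq> q \<and> x $ a $ k \<noteq> 0"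
proof (rule ccontr)
  assume no: "\<not> ?thesis"
  then have xk: "x $ q $ k = v $ k" by (intro eq_demand[OF x]) auto
  have "y $ q $ j \<le> x $ q $ j" for j
  proof (cases "b j = q")
    case True
    then have "x $ q $ j = v $ j" using q by (intro eq_demand[OF x]) (auto simp: all_out_def)
    then show ?thesis using le_demand[OF y] by simp
  next
    case False
    then have "j = k \<or> y $ q $ j = 0" using uniq by blast
    then show ?thesis using xk le_demand[OF y, of q j] nonneg[OF x, of q j] by auto
  qed
  then have "y $ q $ k = x $ q $ k" by (rule row_eqI[OF y x])
  then show False using xk less_demand[OF y, of "b k" k q] supp k by auto
qed

text \<open>
  Edges of \<open>S\<close> that are not protected must be shown to survive by means of the row sums at the
  new vertex: this is how the phases below avoid any bookkeeping of step lengths.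
\<close>

lemma step_exists:
  assumes x: "vertex x" and ins: "\<exists>f\<in>S. insertable (edges x) Pr (fst f) (snd f)"
    and kept: "\<And>x' f. vertex x' \<Longrightarrow> f \<in> S \<Longrightarrow> f \<notin> support x \<Longrightarrow> support x' \<subseteq> insert f (support x) \<Longrightarrow>
       I x' \<and> S \<inter> support x - Pr \<subseteq> support x'"
  shows "\<exists>x'. (vertex x' \<and> I x') \<and> (x, x') \<in> steps \<and> card (S - support x') < card (S - support x)"
proof -
  obtain s j where f: "(s, j) \<in> S" "insertable (edges x) Pr s j" using ins by force
  obtain x' where x': "vertex x'" "pivot (support x) (support x')" "x' $ s $ j \<noteq> 0"
    "support x' \<subseteq> insert (s, j) (support x)" "Pr \<inter> support x \<subseteq> support x'"
    using insert_step[OF x f(2)] by blast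
  have new: "(s, j) \<notin> support x" using f(2) by (simp add: insertable_def)
  have k: "I x'" "S \<inter> support x - Pr \<subseteq> support x'" using kept[OF x'(1) f(1) new x'(4)] by auto
  have "card (S - support x') < card (S - support x)"
    by (rule card_missing_less[of _ _ _ "(s, j)"]) (use k x' f new in auto)
  then show ?thesis using x x' k by (auto simp: pivot_steps_def)
qed

lemma phase_initial:
  assumes x: "vertex x"
  shows "\<exists>l x'. (x, x') \<in> steps ^^ l \<and> vertex x' \<and> (\<exists>t. all_in x' t \<or> all_out x' t) \<and>
    l + card (col - support x') \<le> card (col - support x)"
proof -
  have "\<exists>l x'. (x, x') \<in> steps ^^ l \<and> (vertex x' \<and> True) \<and> (\<exists>t. all_in x' t \<or> all_out x' t) \<and>
    l + card (col - support x') \<le> card (col - support x)"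
  proof (rule steps_until)
    show "vertex x \<and> True" using x by simp
    fix x assume x: "vertex x \<and> True" and "\<not> (\<exists>t. all_in x t \<or> all_out x t)"
    then have "\<exists>j. b j \<noteq> i \<and> x $ i $ j \<noteq> 0" "\<exists>j a. b j = i \<and> a \<noteq> i \<and> x $ a $ j \<noteq> 0" for i
      unfolding all_in_def all_out_def by blast+
    then have "\<exists>j. insertable (edges x) col (b j) j"
      using rows_exhaust[OF dist] dist x
      by (intro tree_support.step_initial[OF tree, of x r m n b col]) (auto simp: col_def)
    then show "\<exists>x'. (vertex x' \<and> True) \<and> (x, x') \<in> steps \<and> card (col - support x') < card (col - support x)"
      using x by (intro step_exists[where Pr = col]) (auto simp: col_def)
  qed
  then show ?thesis by simp
qed

text \<open>Edges inserted in row \<open>t\<close> lead to its own children, so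
  \<open>all_in\<close> is invariant, and \<open>all_in_present\<close> keeps the unprotected
  \<open>(t, k)\<close>. The loop stops exactly when the witnesses \<open>j1\<close> and
  \<open>j2\<close> for \<open>step_in\<close> are no longer both available.\<close>

lemma phase_in:
  assumes x: "vertex x" "all_in x t" and rows: "s \<noteq> q" "s \<noteq> t" "q \<noteq> t" and k: "b k = t"
    and leaf: "\<And>j. b j = t \<Longrightarrow> j \<noteq> k \<Longrightarrow> j \<noteq> c \<and> j \<noteq> d"
  shows "\<exists>l x'. (x, x') \<in> steps ^^ l \<and> (vertex x' \<and> all_in x' t) \<and> (\<not> wants x' s q \<or> all_in x' q) \<and>
    l + card (insert (s, k) col - support x') \<le> card (insert (s, k) col - support x)"
proof (rule steps_until)
  show "vertex x \<and> all_in x t" using x by simp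
  fix x assume x: "vertex x \<and> all_in x t" and go: "\<not> (\<not> wants x s q \<or> all_in x q)"
  let ?Pr = "{(b j, j) | j. j \<noteq> k} \<union> {(s, k)}"
  let ?S = "insert (s, k) col"
  obtain j1 where j1: "b j1 = q" "x $ s $ j1 \<noteq> 0" using go by (auto simp: wants_def)
  obtain j2 where j2: "b j2 \<noteq> q" "x $ q $ j2 \<noteq> 0" using go by (auto simp: all_in_def)
  have tk: "x $ t $ k \<noteq> 0" using x k leaf by (intro all_in_present) auto
  have allin: "\<And>j. x $ t $ j \<noteq> 0 \<Longrightarrow> b j = t" using x by (simp add: all_in_def)
  have ex: "\<And>i. i = s \<or> i = q \<or> i = t" using rows by (intro rows_exhaust)
  have "(\<exists>j. insertable (edges x) ?Pr (b j) j) \<or> insertable (edges x) ?Pr s k"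
    using tree_support.step_in[OF tree[OF conjunct1[OF x]] ex rows k tk allin j1 j2 refl] .
  then have "\<exists>f\<in>?S. insertable (edges x) ?Pr (fst f) (snd f)" by (auto simp: col_def)
  then show "\<exists>x'. (vertex x' \<and> all_in x' t) \<and> (x, x') \<in> steps \<and>
      card (?S - support x') < card (?S - support x)"
  proof (rule step_exists[rotated])
    show "vertex x" using x by simp
    fix x' f assume x': "vertex x'" "f \<in> ?S" "support x' \<subseteq> insert f (support x)"
    have "all_in x' t"
      using x x'(2,3) rows(2) unfolding all_in_def col_def by (auto simp: support_def subset_iff)
    moreover have "x' $ t $ k \<noteq> 0" using all_in_present x'(1) calculation k leaf by blast
    ultimately show "all_in x' t \<and> ?S \<inter> support x - ?Pr \<subseteq> support x'"
      using k by (auto simp: col_def)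
  qed
qed

lemma phase_out:
  assumes x: "vertex x" "all_out x q" and rows: "q \<noteq> p" "q \<noteq> t" "p \<noteq> t" and k: "b k = p"
    and uniq: "\<And>j. y $ q $ j \<noteq> 0 \<Longrightarrow> b j \<noteq> q \<Longrightarrow> j = k"
  shows "\<exists>l x'. (x, x') \<in> steps ^^ l \<and> (vertex x' \<and> all_out x' q) \<and> (\<not> wants x' p t \<or> \<not> wants x' t p) \<and>
    l + card (insert (q, k) col - support x') \<le> card (insert (q, k) col - support x)"
proof (rule steps_until)
  show "vertex x \<and> all_out x q" using x by simp
  fix x assume x: "vertex x \<and> all_out x q" and go: "\<not> (\<not> wants x p t \<or> \<not> wants x t p)"
  let ?Pr = "{(b j, j) | j. j \<noteq> k \<or> x $ t $ k \<noteq> 0} \<union> {(q, k)}"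
  let ?S = "insert (q, k) col"
  have ex: "\<And>i. i = q \<or> i = p \<or> i = t" using rows by (intro rows_exhaust)
  obtain j1 where j1: "b j1 = t" "x $ p $ j1 \<noteq> 0" using go by (auto simp: wants_def)
  obtain j2 where j2: "b j2 = p" "x $ t $ j2 \<noteq> 0" using go by (auto simp: wants_def)
  have pk: "b k \<noteq> q" using k rows by simp
  obtain a where "a \<noteq> q" "x $ a $ k \<noteq> 0" using all_out_present[of x q k, OF _ _ pk uniq] x by blast
  then have "x $ p $ k \<noteq> 0 \<or> x $ t $ k \<noteq> 0" using ex[of a] by auto
  moreover have "\<And>j a. b j = q \<Longrightarrow> x $ a $ j \<noteq> 0 \<Longrightarrow> a = q" using x by (auto simp: all_out_def)
  ultimately have "(\<exists>j. insertable (edges x) ?Pr (b j) j) \<or> insertable (edges x) ?Pr q k"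
    using tree_support.step_out[OF tree[OF conjunct1[OF x]] ex rows k _ _ j1 j2 refl] by blast
  then have "\<exists>f\<in>?S. insertable (edges x) ?Pr (fst f) (snd f)" by (auto simp: col_def)
  then show "\<exists>x'. (vertex x' \<and> all_out x' q) \<and> (x, x') \<in> steps \<and>
      card (?S - support x') < card (?S - support x)"
  proof (rule step_exists[rotated])
    show "vertex x" using x by simp
    fix x' f assume x': "vertex x'" "f \<in> ?S" "support x' \<subseteq> insert f (support x)"
    have ao: "all_out x' q"
      using x x'(2,3) k rows unfolding all_out_def col_def by (auto simp: support_def subset_iff)
    \<comment> \<open>The edge \<open>(t, k)\<close> cannot enter, since it is not in
      \<open>?S\<close>; so the edge of \<open>k\<close> outside row \<open>q\<close> that the row
      sum provides can only be \<open>(p, k)\<close>.\<close>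
    have "x' $ p $ k \<noteq> 0" if "x $ t $ k = 0"
    proof -
      have "(t, k) \<notin> support x'" using that x'(2,3) k rows by (auto simp: col_def subset_iff)
      moreover obtain a where "a \<noteq> q" "x' $ a $ k \<noteq> 0"
        using all_out_present[OF x'(1) ao pk uniq] by blast
      ultimately show ?thesis using ex[of a] by auto
    qed
    then show "all_out x' q \<and> ?S \<inter> support x - ?Pr \<subseteq> support x'"
      using k ao by (auto simp: col_def)
  qed
qed

section \<open>Monotone walks to the target\<close>

lemma target_support: "support y = col \<union> {(m, c), (n, d)}"
  using supp by (auto simp: support_def col_def)

lemma reached:
  assumes "\<exists>l x'. (x, x') \<in> steps ^^ l \<and> (vertex x' \<and> I x') \<and> support y \<subseteq> support x' \<and>
    l + card (support y - support x') \<le> card (support y - support x)"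
  shows "\<exists>l. (x, y) \<in> steps ^^ l \<and> l \<le> card (support y - support x)"
proof -
  obtain l x' where l: "(x, x') \<in> steps ^^ l" "vertex x'" "support y \<subseteq> support x'"
    "l + card (support y - support x') \<le> card (support y - support x)" using assms by blast
  have "y = x'" using vertex_eqI[OF l(2) in_polytope[OF y] l(3)] .
  then show ?thesis using l by auto
qed

lemma uniq_n: "y $ n $ j \<noteq> 0 \<Longrightarrow> b j \<noteq> n \<Longrightarrow> j = d"
  using supp[of n j] dist by auto

lemma uniq_m: "y $ m $ j \<noteq> 0 \<Longrightarrow> b j \<noteq> m \<Longrightarrow> j = c"
  using supp[of m j] dist by auto

lemma leaf_r: "b j = r \<Longrightarrow> j \<noteq> c \<Longrightarrow> j \<noteq> c \<and> j \<noteq> d"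
  using bd dist by auto

text \<open>Both conditions persist under insertion of target edges: in columns with parent
  \<open>n\<close> the target meets only row \<open>n\<close>, and in columns with parent
  \<open>m\<close> it never meets row \<open>r\<close>.\<close>

lemma phase_path:
  assumes x: "vertex x" "all_out x n" "\<not> wants x r m" and cd: "c \<noteq> d"
  shows "\<exists>l. (x, y) \<in> steps ^^ l \<and> l \<le> card (support y - support x)"
proof (rule reached, rule steps_until)
  show "vertex x \<and> (all_out x n \<and> \<not> wants x r m)" using x by simp
  have ex: "\<And>i. i = n \<or> i = m \<or> i = r" using dist by (intro rows_exhaust) auto
  \<comment> \<open>These are the two unprotected target edges. The root is \<open>all_in\<close>,
    which keeps \<open>(r, c)\<close>; column \<open>d\<close> needs an edge outside row
    \<open>n\<close>, and row \<open>r\<close> does not meet it.\<close>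
  have present: "x $ r $ c \<noteq> 0" "x $ m $ d \<noteq> 0"
    if x: "vertex x" "all_out x n" "\<not> wants x r m" for x
  proof -
    have "all_in x r" using x(2,3) ex dist by (auto simp: all_in_def all_out_def wants_def)
    then show "x $ r $ c \<noteq> 0" by (rule all_in_present[OF x(1) _ bc leaf_r])
    have "b d \<noteq> n" using bd[OF cd] dist by simp
    then obtain a where "a \<noteq> n" "x $ a $ d \<noteq> 0" using all_out_present[OF x(1,2) _ uniq_n] by blast
    moreover have "x $ r $ d = 0" using x(3) bd[OF cd] by (auto simp: wants_def)
    ultimately show "x $ m $ d \<noteq> 0" using ex[of a] by auto
  qed
  fix x assume x: "vertex x \<and> (all_out x n \<and> \<not> wants x r m)" and go: "\<not> support y \<subseteq> support x"
  let ?Pr = "{(b j, j) | j. j \<noteq> c \<and> j \<noteq> d} \<union> {(m, c), (n, d)}"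
  have "(\<exists>j. insertable (edges x) ?Pr (b j) j) \<or> insertable (edges x) ?Pr m c \<or> insertable (edges x) ?Pr n d"
  proof (rule tree_support.step_path[OF tree, of x n m r c d b])
    show "(\<exists>j. \<not> x $ b j $ j \<noteq> 0) \<or> \<not> x $ m $ c \<noteq> 0 \<or> \<not> x $ n $ d \<noteq> 0"
      using go by (auto simp: target_support col_def)
  qed (use x ex dist cd bc bd present in \<open>auto simp: all_out_def wants_def\<close>)
  then have "\<exists>f\<in>support y. insertable (edges x) ?Pr (fst f) (snd f)"
    by (auto simp: target_support col_def)
  then show "\<exists>x'. (vertex x' \<and> (all_out x' n \<and> \<not> wants x' r m)) \<and> (x, x') \<in> steps \<and>
      card (support y - support x') < card (support y - support x)"
  proof (rule step_exists[rotated])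
    show "vertex x" using x by simp
    fix x' f assume x': "vertex x'" "f \<in> support y" "support x' \<subseteq> insert f (support x)"
    have new: "x $ i $ j \<noteq> 0 \<or> f = (i, j)" if "x' $ i $ j \<noteq> 0" for i j
      using x'(3) that by (auto simp: subset_iff)
    have f: "f = (i, j) \<Longrightarrow> i = b j \<or> (i = m \<and> j = c) \<or> (i = n \<and> j = d)" for i j using x'(2) supp by auto
    have "a = n" if "b j = n" "x' $ a $ j \<noteq> 0" for a j
      using x new[OF that(2)] f[of a j] that bc bd[OF cd] dist by (auto simp: all_out_def)
    moreover have "x' $ r $ j = 0" if "b j = m" for j
      using x new[of r j] f[of r j] that dist by (auto simp: wants_def)
    ultimately have ao: "all_out x' n" "\<not> wants x' r m" by (auto simp: all_out_def wants_def)
    then show "(all_out x' n \<and> \<not> wants x' r m) \<and> support y \<inter> support x - ?Pr \<subseteq> support x'"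
      using present[OF x'(1)] bc bd[OF cd] by (auto simp: target_support col_def)
  qed
qed

text \<open>In the star the rows \<open>m\<close> and \<open>n\<close> are interchangeable, so
  \<open>p\<close> and \<open>q\<close> may name them in either order.\<close>

lemma phase_star:
  assumes x: "vertex x" "all_out x p" "\<not> wants x r q" and cd: "c = d" and pq: "{p, q} = {m, n}"
  shows "\<exists>l. (x, y) \<in> steps ^^ l \<and> l \<le> card (support y - support x)"
proof (rule reached, rule steps_until)
  show "vertex x \<and> (all_out x p \<and> \<not> wants x r q)" using x by simp
  have pq': "p \<noteq> q" "p \<noteq> r" "q \<noteq> r" using pq dist by (auto simp: doubleton_eq_iff)
  have ex: "\<And>i. i = p \<or> i = q \<or> i = r" using pq' by (intro rows_exhaust) auto
  have ys: "support y = col \<union> {(p, c), (q, c)}"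
    using pq cd by (auto simp: target_support doubleton_eq_iff)
  have present: "x $ r $ c \<noteq> 0"
    if x: "vertex x" "all_out x p" "\<not> wants x r q" for x
  proof -
    have "all_in x r" using x(2,3) ex pq' by (auto simp: all_in_def all_out_def wants_def)
    then show "x $ r $ c \<noteq> 0" by (rule all_in_present[OF x(1) _ bc leaf_r])
  qed
  have outq: "\<exists>j. b j \<noteq> q \<and> x $ q $ j \<noteq> 0" if "vertex x" for x
    using not_all_in_n[OF that] not_all_in_m[OF that cd] pq by (auto simp: all_in_def doubleton_eq_iff)
  fix x assume x: "vertex x \<and> (all_out x p \<and> \<not> wants x r q)" and go: "\<not> support y \<subseteq> support x"
  let ?Pr = "{(b j, j) | j. j \<noteq> c} \<union> {(p, c)} \<union> {(q, c) | j. j \<noteq> c \<and> b j = r \<and> x $ q $ j \<noteq> 0}"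
  have "(\<exists>j. insertable (edges x) ?Pr (b j) j) \<or> insertable (edges x) ?Pr p c \<or> insertable (edges x) ?Pr q c"
  proof (rule tree_support.step_star[OF tree, of x p q r b c])
    show "(\<exists>j. \<not> x $ b j $ j \<noteq> 0) \<or> \<not> x $ p $ c \<noteq> 0 \<or> \<not> x $ q $ c \<noteq> 0"
      using go by (auto simp: ys col_def)
  qed (use x ex pq' bc present outq in \<open>auto simp: all_out_def wants_def\<close>)
  then have "\<exists>f\<in>support y. insertable (edges x) ?Pr (fst f) (snd f)"
    by (auto simp: ys col_def)
  then show "\<exists>x'. (vertex x' \<and> (all_out x' p \<and> \<not> wants x' r q)) \<and> (x, x') \<in> steps \<and>
      card (support y - support x') < card (support y - support x)"
  proof (rule step_exists[rotated])
    show "vertex x" using x by simp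
    fix x' f assume x': "vertex x'" "f \<in> support y" "support x' \<subseteq> insert f (support x)"
    have new: "x $ i $ j \<noteq> 0 \<or> f = (i, j)" if "x' $ i $ j \<noteq> 0" for i j
      using x'(3) that by (auto simp: subset_iff)
    have f: "f = (i, j) \<Longrightarrow> i = b j \<or> (i = p \<and> j = c) \<or> (i = q \<and> j = c)" for i j
      using x'(2) by (auto simp: ys col_def)
    have ao: "all_out x' p" "\<not> wants x' r q"
      using x new f bc pq' unfolding all_out_def wants_def by metis+
    \<comment> \<open>Row \<open>q\<close> is never \<open>all_in\<close>, and what it emits can
      only go to the root. If no other column carried such mass before the step, none does after it,
      which leaves \<open>(q, c)\<close>.\<close>
    have "x' $ q $ c \<noteq> 0" if no: "\<And>j. j \<noteq> c \<Longrightarrow> b j = r \<Longrightarrow> x $ q $ j = 0"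
    proof -
      obtain j where j: "b j \<noteq> q" "x' $ q $ j \<noteq> 0" using outq[OF x'(1)] by blast
      then have "b j = r" using ao(1) ex pq' unfolding all_out_def by metis
      then have "j = c" using no new[OF j(2)] f[of q j] pq' by metis
      then show ?thesis using j by simp
    qed
    then have "(\<exists>j. j \<noteq> c \<and> b j = r \<and> x $ q $ j \<noteq> 0) \<or> x' $ q $ c \<noteq> 0" by blast
    then show "(all_out x' p \<and> \<not> wants x' r q) \<and> support y \<inter> support x - ?Pr \<subseteq> support x'"
      using present[OF x'(1)] ao bc by (auto simp: ys col_def)
  qed
qed


text \<open>
  \<open>e\<close> is the one row edge that may be inserted before the final, monotone phase; in the bound the
  other row edge is charged whether or not it is present.
\<close>

definition finishable :: "3 \<times> 'n \<Rightarrow> (3 \<times> 'n) set \<Rightarrow> real ^ 'n ^ 3 \<Rightarrow> bool" where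
  "finishable e K x \<longleftrightarrow> (\<exists>l. (x, y) \<in> steps ^^ l \<and>
     l \<le> card (insert e col - support x) + card (support y - insert e col - K))"

lemma finishableI:
  assumes "\<exists>l. (x, y) \<in> steps ^^ l \<and> l \<le> card (support y - support x)" and K: "K \<subseteq> support x"
  shows "finishable e K x"
proof -
  have "card (support y - support x) \<le> card ((insert e col - support x) \<union> (support y - insert e col - K))"
    using K by (intro card_mono) auto
  also have "\<dots> \<le> card (insert e col - support x) + card (support y - insert e col - K)"
    by (rule card_Un_le)
  finally show ?thesis using assms(1) unfolding finishable_def by (meson order_trans)
qed

lemma finishable_before:
  assumes "(x, x') \<in> steps ^^ l" "l + card (insert e col - support x') \<le> card (insert e col - support x)"
    and "finishable e K x'"
  shows "finishable e K x"
proof -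
  obtain l' where l': "(x', y) \<in> steps ^^ l'"
    "l' \<le> card (insert e col - support x') + card (support y - insert e col - K)"
    using assms(3) by (auto simp: finishable_def)
  have "(x, y) \<in> steps ^^ (l + l')" using assms(1) l'(1) by (auto simp: relpow_add)
  then show ?thesis using l'(2) assms(2) unfolding finishable_def by (intro exI[of _ "l + l'"]) auto
qed

text \<open>If \<open>t = r\<close>, the loop ends with \<open>m\<close> no longer wanting
  \<open>n\<close>, as \<open>n\<close> is never \<open>all_in\<close>. If \<open>t = m\<close>, the
  root is not \<open>all_out\<close>, so \<open>n\<close> still wants \<open>r\<close> and the loop
  can only have ended with \<open>r\<close> being \<open>all_in\<close>. Either way the monotone
  phase applies.\<close>

lemma finishable_all_in_path:
  assumes cd: "c \<noteq> d" and K: "\<And>x. vertex x \<Longrightarrow> K \<subseteq> support x" and x: "vertex x" "all_in x t"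
  shows "t = r \<and> finishable (m, c) K x \<or> t = m \<and> finishable (n, d) K x"
proof -
  have ex: "\<And>i. i = n \<or> i = m \<or> i = r" using dist by (intro rows_exhaust) auto
  have "t \<noteq> n" using not_all_in_n x by blast
  then consider "t = r" | "t = m" using ex by blast
  then show ?thesis
  proof cases
    case 1
    obtain l x' where l: "(x, x') \<in> steps ^^ l" "vertex x'" "all_in x' r" "\<not> wants x' m n \<or> all_in x' n"
      "l + card (insert (m, c) col - support x') \<le> card (insert (m, c) col - support x)"
      using phase_in[OF x(1) _ _ _ _ bc leaf_r, of m n] x(2) 1 dist by auto
    have "\<not> wants x' m n" using l not_all_in_n by blast
    then have "all_out x' n" "\<not> wants x' r m"
      using l(3) ex dist unfolding all_out_def wants_def all_in_def by metis+
    then have "finishable (m, c) K x'" using phase_path[OF l(2) _ _ cd] K[OF l(2)] by (intro finishableI)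
    then show ?thesis using finishable_before l 1 by blast
  next
    case 2
    obtain l x' where l: "(x, x') \<in> steps ^^ l" "vertex x'" "all_in x' m" "\<not> wants x' n r \<or> all_in x' r"
      "l + card (insert (n, d) col - support x') \<le> card (insert (n, d) col - support x)"
      using phase_in[OF x, of n r d] 2 dist bc bd[OF cd] by auto
    have "wants x' n r"
      using not_all_out_r[OF l(2)] l(3) ex dist unfolding all_out_def wants_def all_in_def by metis
    then have "all_in x' r" using l by blast
    then have "all_out x' n" "\<not> wants x' r m"
      using l(3) ex dist unfolding all_out_def wants_def all_in_def by metis+
    then have "finishable (n, d) K x'" using phase_path[OF l(2) _ _ cd] K[OF l(2)] by (intro finishableI)
    then show ?thesis using finishable_before l 2 by blast
  qed
qed

text \<open>The choice of \<open>s\<close> is left open so that an earlier phase working with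
  \<open>(s, c)\<close> can be continued with the same row edge.\<close>

lemma finishable_all_in_star:
  assumes cd: "c = d" and K: "\<And>x. vertex x \<Longrightarrow> K \<subseteq> support x" and x: "vertex x" "all_in x r"
    and sq: "{s, q} = {m, n}"
  shows "finishable (s, c) K x"
proof -
  have sq': "s \<noteq> q" "s \<noteq> r" "q \<noteq> r" using sq dist by (auto simp: doubleton_eq_iff)
  have ex: "\<And>i. i = s \<or> i = q \<or> i = r" using sq' by (intro rows_exhaust) auto
  obtain l x' where l: "(x, x') \<in> steps ^^ l" "vertex x'" "all_in x' r" "\<not> wants x' s q \<or> all_in x' q"
    "l + card (insert (s, c) col - support x') \<le> card (insert (s, c) col - support x)"
    using phase_in[OF x sq' bc leaf_r] by auto
  have "\<not> wants x' s q"
    using l not_all_in_n[OF l(2)] not_all_in_m[OF l(2) cd] sq by (auto simp: doubleton_eq_iff)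
  then have "all_out x' q" "\<not> wants x' r s"
    using l(3) ex sq' unfolding all_out_def wants_def all_in_def by metis+
  moreover have "{q, s} = {m, n}" using sq by blast
  ultimately have "finishable (s, c) K x'"
    using phase_star[OF l(2) _ _ cd] K[OF l(2)] by (intro finishableI)
  then show ?thesis using finishable_before l by blast
qed

text \<open>An \<open>all_out\<close> row inserts the edge to its own parent column until another
  row becomes \<open>all_in\<close> or the monotone phase applies. The follow-up for that
  \<open>all_in\<close> row uses the same row edge, so a single \<open>e\<close> covers both
  phases.\<close>

lemma finishable_extreme:
  assumes K: "\<And>x. vertex x \<Longrightarrow> K \<subseteq> support x" and x: "vertex x" "all_in x t \<or> all_out x t"
  shows "\<exists>e\<in>{(m, c), (n, d)}. finishable e K x"
proof (cases "c = d")
  case cd: True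
  have in_r: ?thesis if "all_in x t"
  proof -
    have "t = r" using that not_all_in_n not_all_in_m cd x rows_exhaust[OF dist] by metis
    then show ?thesis using finishable_all_in_star[OF cd K x(1), of m n] that by auto
  qed
  show ?thesis
  proof (cases "all_in x t")
    case True then show ?thesis by (rule in_r)
  next
    case False
    then have q: "all_out x t" using x by blast
    then have "t \<noteq> r" using not_all_out_r x by blast
    then obtain q where sq: "{t, q} = {m, n}" using rows_exhaust[OF dist, of t] by blast
    have sq': "t \<noteq> r" "t \<noteq> q" "r \<noteq> q" using sq dist by (auto simp: doubleton_eq_iff)
    have ex: "\<And>i. i = t \<or> i = q \<or> i = r" using sq' by (intro rows_exhaust) auto
    have uniq: "\<And>j. y $ t $ j \<noteq> 0 \<Longrightarrow> b j \<noteq> t \<Longrightarrow> j = c"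
      using uniq_n uniq_m cd sq by (auto simp: doubleton_eq_iff)
    obtain l x' where l: "(x, x') \<in> steps ^^ l" "vertex x'" "all_out x' t" "\<not> wants x' r q \<or> \<not> wants x' q r"
      "l + card (insert (t, c) col - support x') \<le> card (insert (t, c) col - support x)"
      using phase_out[OF x(1) q sq' bc uniq] by auto
    have "\<not> all_in x' q"
      using not_all_in_n[OF l(2)] not_all_in_m[OF l(2) cd] sq by (auto simp: doubleton_eq_iff)
    then have "wants x' q r" using l(3) ex unfolding all_out_def wants_def all_in_def by metis
    then have "all_in x' r" using l(3,4) ex sq' unfolding all_out_def wants_def all_in_def by metis
    then have "finishable (t, c) K x'" using finishable_all_in_star[OF cd K l(2) _ sq] by blast
    then have "finishable (t, c) K x" using finishable_before l by blast
    then show ?thesis using sq cd by (auto simp: doubleton_eq_iff)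
  qed
next
  case cd: False
  have ex: "\<And>i. i = n \<or> i = m \<or> i = r" using dist by (intro rows_exhaust) auto
  show ?thesis
  proof (cases "all_in x t")
    case True then show ?thesis using finishable_all_in_path[OF cd K x(1)] by blast
  next
    case False
    then have q: "all_out x t" using x by blast
    then have "t \<noteq> r" using not_all_out_r x by blast
    then consider "t = n" | "t = m" using ex by blast
    then show ?thesis
    proof cases
      case 1
      obtain l x' where l: "(x, x') \<in> steps ^^ l" "vertex x'" "all_out x' n" "\<not> wants x' m r \<or> \<not> wants x' r m"
        "l + card (insert (n, d) col - support x') \<le> card (insert (n, d) col - support x)"
        using phase_out[OF x(1) q[unfolded 1] dist(3)[symmetric] dist(2)[symmetric] dist(1)[symmetric] bd[OF cd] uniq_n]
        by blast
      have "finishable (n, d) K x'"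
      proof (cases "wants x' r m")
        case True
        then have "all_in x' m" using l(3,4) ex dist unfolding all_out_def wants_def all_in_def by metis
        then show ?thesis using finishable_all_in_path[OF cd K l(2)] dist by blast
      next
        case False
        then show ?thesis using phase_path[OF l(2,3) _ cd] K[OF l(2)] by (intro finishableI)
      qed
      then show ?thesis using finishable_before l by blast
    next
      case 2
      obtain l x' where l: "(x, x') \<in> steps ^^ l" "vertex x'" "all_out x' m" "\<not> wants x' r n \<or> \<not> wants x' n r"
        "l + card (insert (m, c) col - support x') \<le> card (insert (m, c) col - support x)"
        using phase_out[OF x(1) q[unfolded 2] dist(1)[symmetric] dist(3) dist(2) bc uniq_m] by blast
      have "wants x' n r"
        using not_all_in_n[OF l(2)] l(3) ex unfolding all_out_def wants_def all_in_def by metis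
      then have "all_in x' r" using l(3,4) ex dist unfolding all_out_def wants_def all_in_def by metis
      then have "finishable (m, c) K x'" using finishable_all_in_path[OF cd K l(2)] dist by blast
      then show ?thesis using finishable_before l by blast
    qed
  qed
qed

text \<open>The target support splits into \<open>col\<close>, \<open>e\<close> and the other row
  edge, each charged once. The initial phase may lose \<open>e\<close>, so \<open>e\<close> is
  charged in full unless it lies in \<open>K\<close>; edges of \<open>K\<close> belong to every
  support and are never charged.\<close>

lemma target_reachable:
  assumes K: "\<And>x. vertex x \<Longrightarrow> K \<subseteq> support x" and x: "vertex x"
  shows "\<exists>l. (x, y) \<in> steps ^^ l \<and> l \<le> card (support y - K)"
proof -
  obtain l x' where l: "(x, x') \<in> steps ^^ l" "vertex x'" "\<exists>t. all_in x' t \<or> all_out x' t"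
    "l + card (col - support x') \<le> card (col - support x)"
    using phase_initial[OF x] by blast
  obtain e where e: "e \<in> {(m, c), (n, d)}" "finishable e K x'"
    using finishable_extreme[OF K l(2)] l(3) by blast
  obtain l' where l': "(x', y) \<in> steps ^^ l'"
    "l' \<le> card (insert e col - support x') + card (support y - insert e col - K)"
    using e by (auto simp: finishable_def)
  have "e \<notin> col" using e(1) bc bd dist by (cases "c = d") (auto simp: col_def)
  have "e \<in> support y" "col \<subseteq> support y" using e(1) by (auto simp: target_support)
  have "card (insert e col - support x') \<le> card ((col - support x') \<union> ({e} - K))"
    using K[OF l(2)] by (intro card_mono) auto
  also have "\<dots> \<le> card (col - support x') + card ({e} - K)" by (rule card_Un_le)
  finally have "l + l' \<le> card (col - support x) + card ({e} - K) + card (support y - insert e col - K)"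
    using l(4) l'(2) by linarith
  also have "card (col - support x) \<le> card (col - K)" using K[OF x] by (intro card_mono) auto
  also have "card (col - K) + card ({e} - K) = card ((col - K) \<union> ({e} - K))"
    using \<open>e \<notin> col\<close> by (subst card_Un_disjoint) auto
  also have "\<dots> + card (support y - insert e col - K)
      = card (((col - K) \<union> ({e} - K)) \<union> (support y - insert e col - K))"
    by (subst card_Un_disjoint) auto
  also have "((col - K) \<union> ({e} - K)) \<union> (support y - insert e col - K) = support y - K"
    using \<open>e \<in> support y\<close> \<open>col \<subseteq> support y\<close> by auto
  finally have "l + l' \<le> card (support y - K)" by simp
  moreover have "(x, y) \<in> steps ^^ (l + l')" using l(1) l'(1) by (auto simp: relpow_add)
  ultimately show ?thesis by blast
qed

lemma card_target: "card (support y) = CARD('n) + 2"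
proof -
  have "card col = CARD('n)"
  proof -
    have "col = (\<lambda>j. (b j, j)) ` UNIV" by (auto simp: col_def)
    then show ?thesis by (simp add: card_image inj_on_def)
  qed
  moreover have "col \<inter> {(m, c), (n, d)} = {}" using bc bd dist by (cases "c = d") (auto simp: col_def)
  ultimately show ?thesis unfolding target_support using dist by (subst card_Un_disjoint) auto
qed

end

text \<open>If a column meets all three rows, any row can be the root. Otherwise two columns join
  the rows in a path with an end as root. Any further column with two edges would close a square or
  a hexagon.\<close>

lemma rooted_target_exists:
  fixes u :: "real ^ 3" and v :: "real ^ 'n" and y :: "real ^ 'n ^ 3"
  assumes gen: "generic u v" and v: "\<And>j. v $ j > 0"
    and y: "y extreme_point_of transportation_polytope u v"
  shows "\<exists>b r m n c d. rooted_target u v y b r m n c d"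
proof -
  interpret tree_support "\<lambda>i j. y $ i $ j \<noteq> 0" by (rule vertex_tree_support[OF y gen v]) simp_all
  obtain b0 where b0: "\<And>j. y $ b0 j $ j \<noteq> 0" using column_nonempty by metis
  show ?thesis
  proof (cases "\<exists>c. \<forall>i. y $ i $ c \<noteq> 0")
    case True
    then obtain c where c: "\<And>i. y $ i $ c \<noteq> 0" by blast
    have single: "i = b0 j" if "y $ i $ j \<noteq> 0" "j \<noteq> c" for i j
      using no_square[of i j "b0 j" c] that b0 c by blast
    have d: "(1::3) \<noteq> 2" "(1::3) \<noteq> 3" "(2::3) \<noteq> 3" by simp_all
    have "rooted_target u v y (b0(c := 1)) 1 2 3 c c"
    proof
      show "y $ i $ j \<noteq> 0 \<longleftrightarrow> i = (b0(c := 1)) j \<or> i = 2 \<and> j = c \<or> i = 3 \<and> j = c" for i j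
        using single[of i j] b0[of j] c[of i] rows_exhaust[OF d, of i] by auto
    qed (use gen v y d in auto)
    then show ?thesis by blast
  next
    case False
    obtain c a1 where c: "a1 \<noteq> 1" "y $ 1 $ c \<noteq> 0" "y $ a1 $ c \<noteq> 0" using cut[of 1] by blast
    obtain a2 where a2: "y $ a2 $ c = 0" using False by blast
    have d3: "a2 \<noteq> 1" "a2 \<noteq> a1" using a2 c by auto
    obtain d a3 where d: "a3 \<noteq> a2" "y $ a2 $ d \<noteq> 0" "y $ a3 $ d \<noteq> 0" using cut[of a2] by blast
    have a3: "a3 = 1 \<or> a3 = a1" using rows_exhaust[of 1 a1 a2 a3] d c d3 by auto
    \<comment> \<open>Column \<open>d\<close> meets one of the two rows of \<open>c\<close>; this is
      the middle row \<open>a3\<close>. The other row \<open>a0\<close> is an end of the path and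
      becomes the root.\<close>
    define a0 where "a0 = (if a3 = 1 then a1 else 1)"
    have dist: "a0 \<noteq> a3" "a0 \<noteq> a2" "a3 \<noteq> a2" using a3 d c d3 by (auto simp: a0_def)
    have E: "y $ a0 $ c \<noteq> 0" "y $ a3 $ c \<noteq> 0" using a3 c by (auto simp: a0_def)
    have all: "i = a0 \<or> i = a3 \<or> i = a2" for i using rows_exhaust dist by blast
    have cd: "c \<noteq> d" using a2 d by blast
    have a0d: "y $ a0 $ d = 0" using no_square[of a0 c a3 d] E d cd dist by blast
    have single: "i = b0 j" if "y $ i $ j \<noteq> 0" "j \<noteq> c" "j \<noteq> d" for i j
    proof (rule ccontr)
      assume ne: "i \<noteq> b0 j"
      have "y $ a2 $ j \<noteq> 0 \<and> y $ a3 $ j \<noteq> 0 \<or> y $ a0 $ j \<noteq> 0 \<and> y $ a3 $ j \<noteq> 0 \<or> y $ a0 $ j \<noteq> 0 \<and> y $ a2 $ j \<noteq> 0"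
        using ne that b0[of j] all[of i] all[of "b0 j"] by auto
      then show False
        using no_square[of a2 j a3 d] no_square[of a0 j a3 c] no_hexagon[of a0 c a3 d a2 j] that d E cd dist
        by blast
    qed
    have "rooted_target u v y (b0(c := a0, d := a3)) a0 a3 a2 c d"
    proof
      show "y $ i $ j \<noteq> 0 \<longleftrightarrow> i = (b0(c := a0, d := a3)) j \<or> i = a3 \<and> j = c \<or> i = a2 \<and> j = d" for i j
      proof -
        consider "j = c" | "j = d" | "j \<noteq> c" "j \<noteq> d" by blast
        then show ?thesis
        proof cases
          case 1
          then show ?thesis using E a2 all[of i] dist cd by auto
        next
          case 2
          then show ?thesis using d a0d all[of i] dist cd by auto
        next
          case 3
          then show ?thesis using single[of i j] b0[of j] by auto
        qed
      qed
    qed (use gen v y dist cd in auto)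
    then show ?thesis by blast
  qed
qed

lemma generic_reachable:
  fixes u :: "real ^ 3" and v :: "real ^ 'n"
  assumes gen: "generic u v" and v: "\<And>j. v $ j > 0"
    and x: "x extreme_point_of transportation_polytope u v"
    and y: "y extreme_point_of transportation_polytope u v"
    and K: "\<And>z. z extreme_point_of transportation_polytope u v \<Longrightarrow> K \<subseteq> support z"
  shows "\<exists>l. (x, y) \<in> pivot_steps u v ^^ l \<and> l + card K \<le> CARD('n) + 2"
proof -
  obtain b r m n c d where "rooted_target u v y b r m n c d" using rooted_target_exists[OF gen v y] by blast
  then interpret rooted_target u v y b r m n c d .
  obtain l where l: "(x, y) \<in> steps ^^ l" "l \<le> card (support y - K)"
    using target_reachable[OF K x] by blast
  have "card (support y - K) + card K = CARD('n) + 2"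
    using card_Diff_subset[OF finite K[OF y]] card_mono[OF finite K[OF y]] card_target by simp
  then show ?thesis using l by (intro exI[of _ l]) simp
qed

section \<open>Perturbation\<close>

text \<open>Raising every supply by \<open>e\<close> and one demand by \<open>3 * e\<close> keeps
  the totals balanced. A balance between rows \<open>A\<close> and columns \<open>B\<close> then has
  \<open>e\<close>-coefficient \<open>card A\<close> or \<open>card A - 3\<close>, nonzero for every
  proper nonempty \<open>A\<close>, so it holds for at most one \<open>e\<close>.\<close>

definition perturbed :: "real ^ 3 \<Rightarrow> real ^ 'n \<Rightarrow> 'n \<Rightarrow> real \<Rightarrow> (real ^ 'n ^ 3) set" where
  "perturbed u v k e = transportation_polytope (\<chi> i. u $ i + e) (\<chi> j. v $ j + (if j = k then 3 * e else 0))"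

lemma generic_perturbed:
  fixes u :: "real ^ 3" and v :: "real ^ 'n"
  shows "\<forall>\<^sub>F e in at_right 0. generic (\<chi> i. u $ i + e) (\<chi> j. v $ j + (if j = k then 3 * e else 0))"
proof -
  define bad where "bad A B = {e. (\<Sum>i\<in>A. u $ i + e) = (\<Sum>j\<in>B. v $ j + (if j = k then 3 * e else 0))}"
    for A :: "3 set" and B :: "'n set"
  have fin: "finite (bad A B)" if "A \<noteq> {}" "A \<noteq> UNIV" for A B
  proof -
    have "card A > 0" using that by (simp add: card_gt_0_iff)
    moreover have "card A < CARD(3)" using that by (intro psubset_card_mono) auto
    ultimately have A: "0 < card A" "card A < 3" by simp_all
    define q where "q = real (card A) - (if k \<in> B then 3 else 0)"
    have "q \<noteq> 0" using A by (auto simp: q_def)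
    have "e = ((\<Sum>j\<in>B. v $ j) - (\<Sum>i\<in>A. u $ i)) / q" if "e \<in> bad A B" for e
    proof -
      have "(\<Sum>i\<in>A. u $ i) + real (card A) * e = (\<Sum>j\<in>B. v $ j) + (if k \<in> B then 3 * e else 0)"
        using that by (simp add: bad_def sum.distrib)
      then have "q * e = (\<Sum>j\<in>B. v $ j) - (\<Sum>i\<in>A. u $ i)" by (simp add: q_def algebra_simps)
      then show ?thesis using \<open>q \<noteq> 0\<close> by (simp add: field_simps)
    qed
    then have "bad A B \<subseteq> {((\<Sum>j\<in>B. v $ j) - (\<Sum>i\<in>A. u $ i)) / q}" by blast
    then show ?thesis by (rule finite_subset) simp
  qed
  let ?bad = "\<Union>(A, B)\<in>{(A, B). A \<noteq> {} \<and> A \<noteq> UNIV}. bad A B"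
  have "finite ?bad" using fin by (intro finite_UN_I) auto
  then have "\<not> 0 islimpt ?bad" by (simp add: islimpt_finite)
  then have "\<forall>\<^sub>F e in at 0. e \<notin> ?bad" by (simp add: islimpt_iff_eventually)
  then have "\<forall>\<^sub>F e in at_right 0. e \<notin> ?bad" by (rule filter_leD[OF at_le, rotated]) simp
  then show ?thesis by eventually_elim (auto simp: generic_def bad_def)
qed

lemma pigeonhole_frequently:
  assumes "finite T" "F \<noteq> bot" "\<exists>\<^sub>F e in F. \<exists>s\<in>T. Q e s"
  shows "\<exists>s\<in>T. \<exists>\<^sub>F e in F. Q e s"
proof (rule ccontr)
  assume "\<not> ?thesis"
  then have "\<forall>s\<in>T. \<forall>\<^sub>F e in F. \<not> Q e s" by (auto simp: not_frequently)
  then have "\<forall>\<^sub>F e in F. \<forall>s\<in>T. \<not> Q e s" by (rule eventually_ball_finite[OF assms(1)])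
  then show False using assms(3) by (simp add: frequently_def)
qed

lemma linear_limit_nonneg:
  fixes a c :: real
  assumes "\<exists>\<^sub>F e in at_right 0. a + e * c \<ge> 0"
  shows "a \<ge> 0"
proof (rule ccontr)
  assume "\<not> a \<ge> 0"
  have "((\<lambda>e. a + e * c) \<longlongrightarrow> a + 0 * c) (at_right 0)" by (intro tendsto_intros)
  then have "\<forall>\<^sub>F e in at_right 0. a + e * c < 0" using \<open>\<not> a \<ge> 0\<close> by (intro order_tendstoD(2)) auto
  then show False using assms by (simp add: frequently_def not_le)
qed

text \<open>
  Perturbed vertices with a common support depend affinely on \<open>e\<close>, so they extend to \<open>e = 0\<close>.
\<close>

lemma limit_vertex:
  fixes u :: "real ^ 3" and v :: "real ^ 'n"
  assumes freq: "\<exists>\<^sub>F e in at_right 0. \<exists>z. z extreme_point_of perturbed u v k e \<and> support z = S"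
  obtains A B where "A extreme_point_of transportation_polytope u v" "support A \<subseteq> S"
    "\<And>e z. z \<in> perturbed u v k e \<Longrightarrow> support z = S \<Longrightarrow> z = A + e *\<^sub>R B"
proof -
  obtain e1 z1 where 1: "z1 extreme_point_of perturbed u v k e1" "support z1 = S" "e1 > 0"
    using frequently_ex[OF frequently_eventually_frequently[OF freq eventually_at_right_less]] by auto
  have "\<forall>\<^sub>F e in at_right 0. e < e1"
    using eventually_at_right_real[OF 1(3)] by eventually_elim simp
  then obtain e2 z2 where 2: "z2 extreme_point_of perturbed u v k e2" "support z2 = S" "e2 < e1"
    using frequently_ex[OF frequently_eventually_frequently[OF freq]] by blast
  \<comment> \<open>Two parameter values determine the affine family: \<open>B\<close> is its slope
    and \<open>A\<close> its value at \<open>e = 0\<close>.\<close>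
  define B where "B = (1 / (e2 - e1)) *\<^sub>R (z2 - z1)"
  define A where "A = z1 - e1 *\<^sub>R B"
  have z1P: "z1 \<in> perturbed u v k e1" and z2P: "z2 \<in> perturbed u v k e2"
    using 1 2 by (auto simp: extreme_point_of_def)
  have rowB: "(\<Sum>j\<in>UNIV. B $ i $ j) = 1" for i
  proof -
    have "(\<Sum>j\<in>UNIV. B $ i $ j) = (1 / (e2 - e1)) * ((\<Sum>j\<in>UNIV. z2 $ i $ j) - (\<Sum>j\<in>UNIV. z1 $ i $ j))"
      by (simp add: B_def sum_subtractf flip: sum_distrib_left sum_divide_distrib)
    then show ?thesis using z1P z2P 2(3) by (simp add: perturbed_def transportation_polytope_def)
  qed
  have colB: "(\<Sum>i\<in>UNIV. B $ i $ j) = (if j = k then 3 else 0)" for j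
  proof -
    have B: "(\<Sum>i\<in>UNIV. B $ i $ j) = (1 / (e2 - e1)) * ((\<Sum>i\<in>UNIV. z2 $ i $ j) - (\<Sum>i\<in>UNIV. z1 $ i $ j))"
      by (simp add: B_def sum_subtractf flip: sum_distrib_left sum_divide_distrib)
    have z: "(\<Sum>i\<in>UNIV. z2 $ i $ j) - (\<Sum>i\<in>UNIV. z1 $ i $ j) = (if j = k then 3 * (e2 - e1) else 0)"
      using z1P z2P by (simp add: perturbed_def transportation_polytope_def algebra_simps)
    show ?thesis unfolding B z using 2(3) by (auto simp: field_simps)
  qed
  have rowA: "(\<Sum>j\<in>UNIV. A $ i $ j) = u $ i" for i
    using z1P rowB[of i] unfolding A_def
    by (simp add: perturbed_def transportation_polytope_def sum_subtractf flip: sum_distrib_left)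
  have colA: "(\<Sum>i\<in>UNIV. A $ i $ j) = v $ j" for j
    using z1P colB[of j] unfolding A_def
    by (simp add: perturbed_def transportation_polytope_def sum_subtractf flip: sum_distrib_left)
  have suppA: "support A \<subseteq> S" and suppB: "support B \<subseteq> S"
    using 1(2) 2(2) by (auto simp: A_def B_def support_def)
  have unique: "z = A + e *\<^sub>R B" if z: "z \<in> perturbed u v k e" "support z = S" for e z
  proof -
    have "circulation (z - (A + e *\<^sub>R B))"
      using z(1) rowA rowB colA colB
      by (simp add: circulation_def perturbed_def transportation_polytope_def sum_subtractf sum.distrib
          flip: sum_distrib_left)
    moreover have "support (z - (A + e *\<^sub>R B)) \<subseteq> support z1"
      using z(2) suppA suppB 1(2) by (force simp: support_def)
    ultimately have "z - (A + e *\<^sub>R B) = 0"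
      using vertex_circulation_zero[OF 1(1)[unfolded perturbed_def]] by blast
    then show ?thesis by simp
  qed
  have nonneg: "A $ i $ j \<ge> 0" for i j
  proof (rule linear_limit_nonneg[where c = "B $ i $ j"])
    show "\<exists>\<^sub>F e in at_right 0. A $ i $ j + e * B $ i $ j \<ge> 0"
      using freq
    proof (rule frequently_elim1)
      fix e assume "\<exists>z. z extreme_point_of perturbed u v k e \<and> support z = S"
      then obtain z where z: "z \<in> perturbed u v k e" "support z = S" by (auto simp: extreme_point_of_def)
      then have "z $ i $ j \<ge> 0" by (auto simp: perturbed_def transportation_polytope_def)
      then show "A $ i $ j + e * B $ i $ j \<ge> 0" using unique[OF z] by simp
    qed
  qed
  have "A extreme_point_of transportation_polytope u v"
  proof (rule vertexI)
    show "A \<in> transportation_polytope u v"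
      using rowA colA nonneg by (simp add: transportation_polytope_def)
    fix D :: "real ^ 'n ^ 3" assume "circulation D" "support D \<subseteq> support A"
    then show "D = 0"
      using vertex_circulation_zero[OF 1(1)[unfolded perturbed_def]] suppA 1(2) by blast
  qed
  then show thesis using that suppA unique by blast
qed

section \<open>Compactness and limits of perturbed walks\<close>

lemma compact_transportation_polytope: "compact (transportation_polytope u (v :: real ^ 'n) :: (real ^ 'n ^ 'm) set)"
proof -
  have "closed (transportation_polytope u v :: (real ^ 'n ^ 'm) set)"
    unfolding transportation_polytope_def
    by (intro closed_Collect_conj closed_Collect_all closed_Collect_eq closed_Collect_le continuous_intros)
  moreover have "bounded (transportation_polytope u v :: (real ^ 'n ^ 'm) set)"
  proof (rule boundedI)
    fix x :: "real ^ 'n ^ 'm" assume x: "x \<in> transportation_polytope u v"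
    have "norm x \<le> (\<Sum>i\<in>UNIV. norm (x $ i))" unfolding norm_vec_def by (rule L2_set_le_sum) auto
    also have "\<dots> \<le> (\<Sum>i\<in>UNIV. \<Sum>j\<in>UNIV. \<bar>x $ i $ j\<bar>)" by (intro sum_mono norm_le_l1_cart)
    also have "\<dots> = (\<Sum>i\<in>UNIV. u $ i)" using x by (simp add: transportation_polytope_def)
    finally show "norm x \<le> (\<Sum>i\<in>UNIV. u $ i)" .
  qed
  ultimately show ?thesis by (simp add: compact_eq_bounded_closed)
qed

text \<open>The minimisers form a nonempty compact face, and an extreme point of a face is extreme
  in the polytope.\<close>

lemma minimizing_vertex:
  fixes x a :: "real ^ 'n ^ 'm"
  assumes "x \<in> transportation_polytope u v"
  obtains z where "z extreme_point_of transportation_polytope u v" "a \<bullet> z \<le> a \<bullet> x"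
proof -
  let ?P = "transportation_polytope u v :: (real ^ 'n ^ 'm) set"
  have "continuous_on ?P ((\<bullet>) a)" by (intro continuous_intros)
  then obtain w where w: "w \<in> ?P" "\<And>z. z \<in> ?P \<Longrightarrow> a \<bullet> w \<le> a \<bullet> z"
    using continuous_attains_inf[OF compact_transportation_polytope, of u v "(\<bullet>) a"] assms by blast
  let ?F = "?P \<inter> {z. a \<bullet> z = a \<bullet> w}"
  have face: "?F face_of ?P"
    using w(2) by (intro face_of_Int_supporting_hyperplane_ge convex_transportation_polytope)
  have "compact ?F" by (intro compact_Int_closed compact_transportation_polytope closed_hyperplane)
  moreover have "convex ?F" by (intro convex_Int convex_transportation_polytope convex_hyperplane)
  ultimately obtain z where z: "z extreme_point_of ?F" using extreme_point_exists_convex[of ?F] w(1) by blast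
  then have "z extreme_point_of ?P" "z \<in> ?F" using extreme_point_of_face[OF face] by auto
  then show thesis using that w(2)[OF assms] by auto
qed

text \<open>Different perturbed vertices can have the same limit; the resulting stationary steps are
  dropped here.\<close>

lemma relpow_reflcl:
  "(x, y) \<in> (E\<^sup>=) ^^ l \<Longrightarrow> \<exists>l'\<le>l. (x, y) \<in> E ^^ l'"
proof (induction l arbitrary: y)
  case (Suc l)
  then obtain z where z: "(x, z) \<in> (E\<^sup>=) ^^ l" "(z, y) \<in> E\<^sup>=" by auto
  then obtain l' where "l' \<le> l" "(x, z) \<in> E ^^ l'" using Suc.IH by blast
  show ?case
  proof (cases "z = y")
    case True
    then show ?thesis using \<open>l' \<le> l\<close> \<open>(x, z) \<in> E ^^ l'\<close> by (intro exI[of _ l']) simp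
  next
    case False
    then have "(x, y) \<in> E ^^ Suc l'" using \<open>(x, z) \<in> E ^^ l'\<close> z(2) by (auto intro: relpow_Suc_I)
    then show ?thesis using \<open>l' \<le> l\<close> by (intro exI[of _ "Suc l'"]) simp
  qed
qed simp

lemma vertex_distance:
  fixes u :: "real ^ 3" and v :: "real ^ 'n"
  assumes v: "\<And>j. v $ j > 0"
    and x: "x extreme_point_of transportation_polytope u v"
    and y: "y extreme_point_of transportation_polytope u v"
  shows "\<exists>l. (x, y) \<in> skeleton_edges (transportation_polytope u v) ^^ l \<and>
    l + card (critical_edges (transportation_polytope u v)) \<le> CARD('n) + 2"
proof -
  let ?P = "transportation_polytope u v :: (real ^ 'n ^ 3) set"
  let ?K = "critical_edges ?P"
  let ?N = "CARD('n) + 2"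
  define k :: 'n where "k = undefined"
  define Q where "Q e = perturbed u v k e" for e
  have bot: "at_right (0::real) \<noteq> bot" by simp
  \<comment> \<open>Otherwise a single support missing a critical edge recurs for arbitrarily small
    \<open>e\<close>, and its limit vertex is a point of \<open>?P\<close> that vanishes on that
    edge.\<close>
  have eK: "\<forall>\<^sub>F e in at_right 0. \<forall>z. z extreme_point_of Q e \<longrightarrow> ?K \<subseteq> support z"
  proof (rule ccontr)
    assume "\<not> ?thesis"
    then have "\<exists>\<^sub>F e in at_right 0. \<exists>S\<in>UNIV. (\<exists>z. z extreme_point_of Q e \<and> support z = S) \<and> \<not> ?K \<subseteq> S"
      unfolding not_eventually by (auto elim!: frequently_elim1)
    then have "\<exists>S\<in>UNIV. \<exists>\<^sub>F e in at_right 0. (\<exists>z. z extreme_point_of Q e \<and> support z = S) \<and> \<not> ?K \<subseteq> S"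
      by (intro pigeonhole_frequently bot finite)
    then obtain S where S: "\<exists>\<^sub>F e in at_right 0. (\<exists>z. z extreme_point_of Q e \<and> support z = S) \<and> \<not> ?K \<subseteq> S"
      by blast
    then have "\<not> ?K \<subseteq> S" using frequently_ex by blast
    moreover have "\<exists>\<^sub>F e in at_right 0. \<exists>z. z extreme_point_of perturbed u v k e \<and> support z = S"
      using S by (rule frequently_elim1) (simp add: Q_def)
    then obtain A where "A extreme_point_of ?P" "support A \<subseteq> S" by (rule limit_vertex)
    ultimately show False by (force simp: critical_edges_def extreme_point_of_def support_def)
  qed
  \<comment> \<open>Minimising the mass outside the support of \<open>x\<close> selects perturbed vertices that tend to \<open>x\<close>.\<close>
  define cost :: "real ^ 'n ^ 3 \<Rightarrow> real ^ 'n ^ 3 \<Rightarrow> real" where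
    "cost x z = (\<chi> i j. of_bool (x $ i $ j = 0)) \<bullet> z" for x z
  have cost_sum: "cost x z = (\<Sum>i\<in>UNIV. \<Sum>j\<in>UNIV. of_bool (x $ i $ j = 0) * z $ i $ j)" for x z
    by (simp add: cost_def inner_vec_def)
  define near where "near e w S \<longleftrightarrow> (\<exists>z. z extreme_point_of Q e \<and> support z = S \<and> cost w z \<le> 3 * e)" for e w S
  have near_ex: "\<exists>z. z extreme_point_of Q e \<and> cost w z \<le> 3 * e" if w: "w \<in> ?P" and e: "e > 0" for w e
  proof -
    \<comment> \<open>Putting the extra \<open>e\<close> of each row into column \<open>k\<close>
      makes \<open>w\<close> feasible for \<open>Q e\<close>, at a cost of at most
      \<open>3 * e\<close>.\<close>
    define J :: "real ^ 'n ^ 3" where "J = (\<chi> i j. if j = k then 1 else 0)"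
    have wJ: "w + e *\<^sub>R J \<in> Q e"
      using w e by (simp add: Q_def perturbed_def J_def transportation_polytope_def sum.distrib if_distrib[of "(*) e"]
         flip: sum_distrib_left cong: if_cong)
    obtain z where z: "z extreme_point_of Q e" "cost w z \<le> cost w (w + e *\<^sub>R J)"
      using minimizing_vertex[OF wJ[unfolded Q_def perturbed_def], of "\<chi> i j. of_bool (w $ i $ j = 0)"]
      unfolding Q_def perturbed_def cost_def by blast
    have "cost w (w + e *\<^sub>R J) = (\<Sum>i\<in>UNIV. \<Sum>j\<in>UNIV. of_bool (w $ i $ j = 0) * (e * J $ i $ j))"
      unfolding cost_sum by (intro sum.cong refl) auto
    also have "\<dots> \<le> (\<Sum>i\<in>(UNIV :: 3 set). \<Sum>j\<in>UNIV. if j = k then e else 0)"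
      using e by (intro sum_mono) (auto simp: J_def)
    also have "\<dots> = 3 * e" by simp
    finally show ?thesis using z by auto
  qed
  have near_limit: "A = w"
    if w: "w extreme_point_of ?P" and A: "A extreme_point_of ?P"
      and AB: "\<And>e z. z \<in> Q e \<Longrightarrow> support z = S \<Longrightarrow> z = A + e *\<^sub>R B"
      and freq: "\<exists>\<^sub>F e in at_right 0. near e w S" for A B w S
  proof -
    have AP: "A \<in> ?P" using A by (simp add: extreme_point_of_def)
    \<comment> \<open>The cost bound is affine in \<open>e\<close> along the family, so it persists
      at \<open>e = 0\<close>, where it says that \<open>A\<close> has no mass outside the support
      of \<open>w\<close>.\<close>
    have "- cost w A \<ge> 0"
    proof (rule linear_limit_nonneg[where c = "3 - cost w B"])
      show "\<exists>\<^sub>F e in at_right 0. - cost w A + e * (3 - cost w B) \<ge> 0"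
        using freq
      proof (rule frequently_elim1)
        fix e assume "near e w S"
        then obtain z where "z \<in> Q e" "support z = S" "cost w z \<le> 3 * e"
          by (auto simp: near_def extreme_point_of_def)
        then have "cost w (A + e *\<^sub>R B) \<le> 3 * e" using AB by metis
        then show "- cost w A + e * (3 - cost w B) \<ge> 0"
          by (simp add: cost_def inner_add_right algebra_simps)
      qed
    qed
    moreover have nn: "of_bool (w $ i $ j = 0) * A $ i $ j \<ge> 0" for i j
      using transportation_polytopeD(3)[OF AP] by simp
    ultimately have "cost w A = 0" unfolding cost_sum using nn by (intro antisym sum_nonneg) auto
    have "of_bool (w $ i $ j = 0) * A $ i $ j \<le> cost w A" for i j
    proof -
      have "of_bool (w $ i $ j = 0) * A $ i $ j \<le> (\<Sum>j\<in>UNIV. of_bool (w $ i $ j = 0) * A $ i $ j)"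
        by (intro member_le_sum nn) auto
      also have "\<dots> \<le> cost w A" unfolding cost_sum by (intro member_le_sum sum_nonneg nn) auto
      finally show ?thesis .
    qed
    then have "of_bool (w $ i $ j = 0) * A $ i $ j = 0" for i j
      using nn[of i j] \<open>cost w A = 0\<close> by (metis antisym)
    then have "support A \<subseteq> support w" by (auto simp: support_def)
    then show ?thesis using vertex_eqI[OF w AP] by simp
  qed
  \<comment> \<open>A walk is recorded by its supports alone. There are finitely many lists of
    bounded length, so one list recurs for arbitrarily small \<open>e\<close>; it has one entry more
    than the walk has steps.\<close>
  define good where "good e Ss \<longleftrightarrow> Ss \<noteq> [] \<and> near e x (hd Ss) \<and> near e y (last Ss) \<and>
      (\<forall>S\<in>set Ss. \<exists>z. z extreme_point_of Q e \<and> support z = S) \<and>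
      (\<forall>i. Suc i < length Ss \<longrightarrow> pivot (Ss ! i) (Ss ! Suc i))" for e Ss
  let ?T = "{Ss :: (3 \<times> 'n) set list. set Ss \<subseteq> UNIV \<and> length Ss \<le> Suc (?N - card ?K)}"
  have xP: "x \<in> ?P" and yP: "y \<in> ?P" using x y by (auto simp: extreme_point_of_def)
  have ev: "\<forall>\<^sub>F e in at_right 0. card ?K \<le> ?N \<and> (\<exists>Ss\<in>?T. good e Ss)"
    using generic_perturbed[of u v k] eK eventually_at_right_less
  proof eventually_elim
    case (elim e)
    let ?u = "\<chi> i. u $ i + e" and ?v = "\<chi> j. v $ j + (if j = k then 3 * e else 0)"
    have Qe: "Q e = transportation_polytope ?u ?v" by (simp add: Q_def perturbed_def)
    obtain x' where x': "x' extreme_point_of Q e" "cost x x' \<le> 3 * e" using near_ex xP elim(3) by blast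
    obtain y' where y': "y' extreme_point_of Q e" "cost y y' \<le> 3 * e" using near_ex yP elim(3) by blast
    have "\<exists>l. (x', y') \<in> pivot_steps ?u ?v ^^ l \<and> l + card ?K \<le> ?N"
    proof (rule generic_reachable[OF elim(1)])
      show "?v $ j > 0" for j using v[of j] elim(3) by (auto intro!: add_pos_pos)
    qed (use x' y' elim(2) in \<open>auto simp: Qe\<close>)
    then obtain l where l: "(x', y') \<in> pivot_steps ?u ?v ^^ l" "l + card ?K \<le> ?N" by blast
    then obtain f where f: "f 0 = x'" "f l = y'" "\<And>i. i < l \<Longrightarrow> (f i, f (Suc i)) \<in> pivot_steps ?u ?v"
      by (auto simp: relpow_fun_conv)
    have fv: "f i extreme_point_of Q e" if "i \<le> l" for i
      using that f(1,3) x'(1) f(3)[of "i - 1"] by (cases i) (auto simp: pivot_steps_def Qe)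
    let ?Ss = "map (\<lambda>i. support (f i)) [0..<Suc l]"
    have "good e ?Ss" unfolding good_def near_def
    proof (intro conjI)
      show "\<exists>z. z extreme_point_of Q e \<and> support z = hd ?Ss \<and> cost x z \<le> 3 * e"
        using x' f(1) by (intro exI[of _ x']) (simp add: hd_map del: upt_Suc)
      show "\<exists>z. z extreme_point_of Q e \<and> support z = last ?Ss \<and> cost y z \<le> 3 * e"
        using y' f(2) by (intro exI[of _ y']) simp
      show "\<forall>S\<in>set ?Ss. \<exists>z. z extreme_point_of Q e \<and> support z = S" 
        using fv by (fastforce simp: less_Suc_eq_le simp del: upt_Suc)
      show "\<forall>i. Suc i < length ?Ss \<longrightarrow> pivot (?Ss ! i) (?Ss ! Suc i)"
        using f(3) by (auto simp: pivot_steps_def simp del: upt_Suc)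
    qed simp
    moreover have "?Ss \<in> ?T" using l(2) by simp
    ultimately show ?case using l(2) by (intro conjI bexI[of _ ?Ss]) auto
  qed
  then have K: "card ?K \<le> ?N" using eventually_happens'[OF bot] by blast
  have "\<exists>\<^sub>F e in at_right 0. \<exists>Ss\<in>?T. good e Ss"
    using ev by (intro eventually_frequently bot) (auto elim: eventually_mono)
  then have "\<exists>Ss\<in>?T. \<exists>\<^sub>F e in at_right 0. good e Ss"
    by (intro pigeonhole_frequently bot finite_lists_length_le finite)
  then obtain Ss where Ss: "Ss \<in> ?T" "\<exists>\<^sub>F e in at_right 0. good e Ss" by blast
  have good: "Ss \<noteq> []" "\<And>i. Suc i < length Ss \<Longrightarrow> pivot (Ss ! i) (Ss ! Suc i)"
    using frequently_ex[OF Ss(2)] by (auto simp: good_def)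
  have "\<exists>A B. A extreme_point_of ?P \<and> support A \<subseteq> S \<and> (\<forall>e z. z \<in> Q e \<longrightarrow> support z = S \<longrightarrow> z = A + e *\<^sub>R B)"
    if "S \<in> set Ss" for S
  proof -
    have "\<exists>\<^sub>F e in at_right 0. \<exists>z. z extreme_point_of perturbed u v k e \<and> support z = S"
      using Ss(2) by (rule frequently_elim1) (use that in \<open>auto simp: good_def Q_def\<close>)
    then obtain A B where "A extreme_point_of ?P" "support A \<subseteq> S"
      "\<And>e z. z \<in> perturbed u v k e \<Longrightarrow> support z = S \<Longrightarrow> z = A + e *\<^sub>R B"
      by (rule limit_vertex) blast
    then show ?thesis unfolding Q_def by blast
  qed
  then obtain A B where AB: "\<And>S. S \<in> set Ss \<Longrightarrow> A S extreme_point_of ?P" "\<And>S. S \<in> set Ss \<Longrightarrow> support (A S) \<subseteq> S"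
    "\<And>S e z. S \<in> set Ss \<Longrightarrow> z \<in> Q e \<Longrightarrow> support z = S \<Longrightarrow> z = A S + e *\<^sub>R B S" by metis
  let ?l = "length Ss - 1"
  have "(A (Ss ! 0), A (Ss ! ?l)) \<in> ((skeleton_edges ?P)\<^sup>=) ^^ ?l"
    unfolding relpow_fun_conv
  proof (intro exI[of _ "\<lambda>i. A (Ss ! i)"] conjI allI impI refl)
    fix i assume "i < ?l"
    then have i: "Ss ! i \<in> set Ss" "Ss ! Suc i \<in> set Ss" "Suc i < length Ss" by auto
    show "(A (Ss ! i), A (Ss ! Suc i)) \<in> (skeleton_edges ?P)\<^sup>="
      using pivot_edge[OF AB(1)[OF i(1)] AB(1)[OF i(2)] _ AB(2)[OF i(1)] AB(2)[OF i(2)] good(2)[OF i(3)]]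
        AB(1) i by (auto simp: skeleton_edges_def skeleton_vertices_def)
  qed
  moreover have "A (Ss ! 0) = x"
  proof (rule near_limit[OF x AB(1) AB(3)])
    show "\<exists>\<^sub>F e in at_right 0. near e x (Ss ! 0)"
      using Ss(2) by (rule frequently_elim1) (auto simp: good_def hd_conv_nth)
  qed (use good in auto)
  moreover have "A (Ss ! ?l) = y"
  proof (rule near_limit[OF y AB(1) AB(3)])
    show "\<exists>\<^sub>F e in at_right 0. near e y (Ss ! ?l)"
      using Ss(2) by (rule frequently_elim1) (auto simp: good_def last_conv_nth)
  qed (use good in auto)
  ultimately obtain l where "l \<le> ?l" "(x, y) \<in> skeleton_edges ?P ^^ l" using relpow_reflcl by metis
  then show ?thesis using Ss(1) K by (intro exI[of _ l]) auto
qed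

theorem theorem4:
  fixes u :: "real ^ 3" and v :: "real ^ 'n" and P :: "(real ^ 'n ^ 3) set" and k :: nat
  assumes u_pos: "\<And>i. u $ i > 0"
    and v_pos: "\<And>j. v $ j > 0"
    and balanced: "(\<Sum>i\<in>UNIV. u $ i) = (\<Sum>j\<in>UNIV. v $ j)"
    and P_def: "P = transportation_polytope u v"
    and k_def: "k = card (critical_edges P)"
  shows "graph_diameter P + enat k \<le> enat (CARD('n) + 2) \<and>
         graph_diameter P \<le> enat (CARD('n) + 2)"
proof -
  define s where "s = (\<Sum>i\<in>UNIV. u $ i)"
  have s: "s > 0" using u_pos by (auto simp: s_def intro: sum_pos)
  \<comment> \<open>This product point shows that \<open>P\<close> is nonempty and hence has a
    vertex. The distance bound at that vertex gives \<open>k \<le> CARD('n) + 2\<close>, so that the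
    truncated subtraction below is exact.\<close>
  have "(\<chi> i j. u $ i * v $ j / s) \<in> P"
    unfolding P_def transportation_polytope_def using s u_pos v_pos balanced
    by (auto simp: s_def less_imp_le simp flip: sum_distrib_left sum_distrib_right sum_divide_distrib)
  then obtain z where z: "z extreme_point_of P" using minimizing_vertex unfolding P_def by metis
  have k: "k \<le> CARD('n) + 2" using vertex_distance[OF v_pos, of z u z] z by (auto simp: k_def P_def)
  have "graph_diameter P \<le> enat (CARD('n) + 2 - k)"
    unfolding graph_diameter_def
  proof (intro SUP_least)
    fix x y assume "x \<in> skeleton_vertices P" "y \<in> skeleton_vertices P"
    then obtain l where l: "(x, y) \<in> skeleton_edges P ^^ l" "l + k \<le> CARD('n) + 2"
      using vertex_distance[OF v_pos, of x u y] by (auto simp: skeleton_vertices_def P_def k_def)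
    have "graph_distance (skeleton_edges P) x y \<le> enat l"
      unfolding graph_distance_def using l(1) by (intro INF_lower) simp
    also have "\<dots> \<le> enat (CARD('n) + 2 - k)" using l(2) by simp
    finally show "graph_distance (skeleton_edges P) x y \<le> enat (CARD('n) + 2 - k)" .
  qed
  then have "graph_diameter P + enat k \<le> enat (CARD('n) + 2 - k) + enat k" by (rule add_right_mono)
  also have "\<dots> = enat (CARD('n) + 2)" using k by simp
  finally have 1: "graph_diameter P + enat k \<le> enat (CARD('n) + 2)" .
  moreover have "graph_diameter P \<le> graph_diameter P + enat k" by simp
  ultimately show ?thesis using order_trans by blast
qed

end
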